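(* Let $0<L\le U$, let $k\ge1$ be an integer, and consider ROS-$(\delta,\Delta)$ with $\delta\in(0,1]$ and $\Delta=k-1$. The $\mathsf{CVaR}_\delta\text{-CR}$ of cPPM-$\boldsymbol\phi$ (with one unit reserved at each of the $k$ price levels) is $\alpha$ if the following two conditions hold. (i) $\alpha\ge1$ satisfies $$\alpha=\frac{kU\delta}{\sum_{i=1}^k\int_0^\delta\phi_i(\eta)\,d\eta}.$$ (ii) The pricing functions $\boldsymbol\phi=\{\phi_i\}_{i\in[k]}$ on $[0,1]$ are defined recursively (with parameter $\alpha$) as follows, where $m=\lfloor k/\alpha\rfloor$ and $A=\frac{k}{\alpha}-m$: - for $i\in\{1,\dots,m\}$, $\phi_i(x)=L$ for all $x\in[0,1]$; - for $i=m+1$, $$\phi_i(x)=\begin{cases}L, & x\in[0,1-\delta+A\delta],\\[1mm] \dfrac{\alpha}{k\delta}\left(mL\delta+\displaystyle\int_0^{\delta-1+x}\phi_i(\eta)\,d\eta\right), & x\in[1-\delta+A\delta,1];\end{cases}$$ - for $i\in\{m+2,\dots,k\}$ and $x\in[0,1]$, $$\phi_i(x)=\frac{\alpha}{k\delta}\left(\sum_{j=1}^{i-1}\int_x^{\min\{1,x+\delta\}}\phi_j(\eta)\,d\eta+\sum_{j=1}^{i}\int_0^{\max\{0,\delta-1+x\}}\phi_j(\eta)\,d\eta\right).$$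
   Context: Problem ROS-$(\delta,\Delta)$ (with $\delta\in(0,1]$, $\Delta\in\{0,\dots,k-1\}$): a seller has $k$ identical units. Buyers $t=1,\dots,T$ arrive one by one; buyer $t$ has a private value $v_t\in[L,U]$, where $0<L\le U$ are known. When buyer $t$ arrives the seller posts a price $p_t$; if units remain, the buyer accepts and buys one unit ($x_t=1$) if $v_t\ge p_t$ and otherwise leaves ($x_t=0$). At most $k$ units can be sold. Prices are chosen (possibly at random) without knowing the future values or $T$, with at most $\Delta$ price changes. For an instance $I=(v_1,\dots,v_T)$, $\mathrm{ALG}(I,P)=\sum_t v_tx_t$ is the (random) social welfare, and $\mathrm{OPT}(I)$ is the sum of the $k$ highest values in $I$ (all values if $T<k$). $\mathsf{CVaR}_\delta[X]=\sup_{\tau\in\mathbb R}\{\tau-\frac1\delta\mathbb E[(\tau-X)_+]\}$, where $(x)_+=\max\{x,0\}$. $\mathsf{CVaR}_\delta\text{-CR}(\mathrm{ALG})=\sup_I \mathrm{OPT}(I)/\mathsf{CVaR}_\delta[\mathrm{ALG}(I,P)]$, the supremum being over all instances (any $T\ge1$, any values in $[L,U]$). Mechanism cPPM-$\boldsymbol\phi$ with $\Delta=k-1$ and one unit reserved per level: draw a single seed $R$ uniformly from $[0,1]$; while $y<k$ units have been sold, post the price $\phi_{y+1}(R)$ to the arriving buyer, who buys one unit if and only if the buyer's value is at least this price. After $k$ sales nothing more is sold. The recursive equations in which $\phi_i$ appears on both sides are understood as integral equations for a continuous function $\phi_i$ on $[0,1]$. Notation: $[n]=\{1,\dots,n\}$.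 *)

theory Defs
  imports "HOL-Probability.Probability"
begin

text \<open>
  A (deterministic) pricing policy maps the list of accept/reject decisions of the previous
  buyers to the price posted to the next one; values are private, so they are not visible to it,
  and neither is the number of buyers. A randomized policy is a family of such policies indexed
  by a random seed. An instance is the list of the buyers' values in order of arrival.
\<close>

type_synonym policy = "bool list \<Rightarrow> real"

text \<open>\<open>decisions_from k p h vs\<close> extends the decisions \<open>h\<close> already taken by those of the buyers \<open>vs\<close>.\<close>

fun decisions_from :: "nat \<Rightarrow> policy \<Rightarrow> bool list \<Rightarrow> real list \<Rightarrow> bool list" where
  "decisions_from k p h [] = h"
| "decisions_from k p h (v # vs) =
     decisions_from k p (h @ [count_list h True < k \<and> p h \<le> v]) vs"

definition decisions :: "nat \<Rightarrow> policy \<Rightarrow> real list \<Rightarrow> bool list" where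
  "decisions k p I = decisions_from k p [] I"

definition ALG :: "nat \<Rightarrow> policy \<Rightarrow> real list \<Rightarrow> real" where
  "ALG k p I = (\<Sum>t<length I. I ! t * of_bool (decisions k p I ! t))"

definition OPT :: "nat \<Rightarrow> real list \<Rightarrow> real" where
  "OPT k I = sum_list (take k (rev (sort I)))"

definition instances :: "real \<Rightarrow> real \<Rightarrow> real list set" where
  "instances L U = {I. I \<noteq> [] \<and> set I \<subseteq> {L..U}}"

definition CVaR :: "real \<Rightarrow> 'r measure \<Rightarrow> ('r \<Rightarrow> real) \<Rightarrow> ereal" where
  "CVaR \<delta> M X = (SUP \<tau>::real. ereal (\<tau> - 1 / \<delta> * (\<integral>\<omega>. max (\<tau> - X \<omega>) 0 \<partial>M)))"

text \<open>
  For \<open>ereal\<close>, a positive number divided by \<open>0\<close> is \<open>\<infinity>\<close>, so an instance on which the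
  conditional value at risk vanishes makes the ratio infinite.
\<close>

definition CVaR_CR ::
  "real \<Rightarrow> nat \<Rightarrow> real \<Rightarrow> real \<Rightarrow> 'r measure \<Rightarrow> ('r \<Rightarrow> policy) \<Rightarrow> ereal" where
  "CVaR_CR \<delta> k L U M P =
     (SUP I\<in>instances L U. ereal (OPT k I) / CVaR \<delta> M (\<lambda>\<omega>. ALG k (P \<omega>) I))"

text \<open>
  The seed space is the restriction of \<open>lborel\<close> to \<open>[0,1]\<close>, and not the uniform measure on all of
  \<open>\<real>\<close>: the pricing functions are unconstrained, possibly non-measurable, outside \<open>[0,1]\<close>.
\<close>

definition unit_seed :: "real measure" where
  "unit_seed = restrict_space lborel {0..1}"

lemma prob_space_unit_seed: "prob_space unit_seed"
  unfolding unit_seed_def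
  by (rule prob_spaceI) (simp add: space_restrict_space emeasure_restrict_space)

definition cPPM :: "(nat \<Rightarrow> real \<Rightarrow> real) \<Rightarrow> real \<Rightarrow> policy" where
  "cPPM \<phi> R h = \<phi> (count_list h True + 1) R"

text \<open>Prices count only while units remain; afterwards nothing can be sold.\<close>

definition posted_prices :: "nat \<Rightarrow> policy \<Rightarrow> real list \<Rightarrow> real list" where
  "posted_prices k p I =
     map p (filter (\<lambda>h. count_list h True < k) (map (\<lambda>t. take t (decisions k p I)) [0..<length I]))"

definition price_changes :: "real list \<Rightarrow> nat" where
  "price_changes ps = card {t. Suc t < length ps \<and> ps ! t \<noteq> ps ! Suc t}"

lemma cPPM_price_changes_le: "price_changes (posted_prices k (cPPM \<phi> R) I) \<le> k - 1"
proof -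
  define d where "d = decisions k (cPPM \<phi> R) I"
  define c where "c = (\<lambda>h. count_list h True)"
  define cs where "cs = filter (\<lambda>n. n < k) (map c (map (\<lambda>t. take t d) [0..<length I]))"
  have ps: "posted_prices k (cPPM \<phi> R) I = map (\<lambda>n. \<phi> (n + 1) R) cs"
    by (simp add: posted_prices_def cs_def filter_map comp_def cPPM_def c_def d_def)
  have mono: "c (take s d) \<le> c (take t d)" if "s \<le> t" for s t
  proof -
    have "take t d = take s d @ take (t - s) (drop s d)"
      using that by (metis le_add_diff_inverse take_add)
    then show ?thesis by (simp add: c_def)
  qed
  have "sorted (map c (map (\<lambda>t. take t d) [0..<length I]))"
    by (auto simp: sorted_iff_nth_mono intro: mono)
  then have cs_sorted: "sorted cs"
    unfolding cs_def using sorted_filter[where f = "\<lambda>x. x"] by simp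
  have lt: "cs ! t < k" if "t < length cs" for t
    using nth_mem[OF that] by (auto simp: cs_def)
  define S where "S = {t. Suc t < length cs \<and> cs ! t \<noteq> cs ! Suc t}"
  have step: "cs ! t < cs ! Suc t" if "t \<in> S" for t
    using that sorted_nth_mono[OF cs_sorted, of t "Suc t"] by (auto simp: S_def)
  have less: "cs ! s < cs ! t" if "s \<in> S" "t \<in> S" "s < t" for s t
    using step[OF that(1)] sorted_nth_mono[OF cs_sorted, of "Suc s" t] that by (auto simp: S_def)
  have "inj_on (\<lambda>t. cs ! t) S"
    by (rule inj_onI) (metis less less_irrefl linorder_neqE_nat)
  moreover have "(\<lambda>t. cs ! t) ` S \<subseteq> {..<k - 1}"
  proof safe
    fix t assume "t \<in> S"
    then show "cs ! t < k - 1" using step[of t] lt[of "Suc t"] by (simp add: S_def)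
  qed
  ultimately have "card S \<le> k - 1"
    by (metis card_image card_mono finite_lessThan card_lessThan)
  moreover have "{t. Suc t < length (map (\<lambda>n. \<phi> (n + 1) R) cs) \<and>
      map (\<lambda>n. \<phi> (n + 1) R) cs ! t \<noteq> map (\<lambda>n. \<phi> (n + 1) R) cs ! Suc t} \<subseteq> S"
    by (auto simp: S_def)
  moreover have "finite S"
    by (rule finite_subset[of _ "{..<length cs}"]) (auto simp: S_def)
  ultimately show ?thesis
    unfolding ps price_changes_def using card_mono by (meson le_trans)
qed

text \<open>
  The pricing functions \<open>\<phi> 1, \<dots>, \<phi> k\<close>, as continuous solutions on \<open>[0,1]\<close> of the integral
  equations with parameter \<open>\<alpha>\<close>. The case \<open>i = m + 1\<close> is void when \<open>m = k\<close>.
\<close>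

definition pricing_equations ::
  "real \<Rightarrow> nat \<Rightarrow> real \<Rightarrow> real \<Rightarrow> (nat \<Rightarrow> real \<Rightarrow> real) \<Rightarrow> bool" where
  "pricing_equations \<delta> k L \<alpha> \<phi> \<longleftrightarrow>
    (let m = nat \<lfloor>real k / \<alpha>\<rfloor>; A = real k / \<alpha> - real m in
      (\<forall>i\<in>{1..k}. continuous_on {0..1} (\<phi> i)) \<and>
      (\<forall>i\<in>{1..k}.
        (i \<le> m \<longrightarrow> (\<forall>x\<in>{0..1}. \<phi> i x = L)) \<and>
        (i = m + 1 \<longrightarrow>
          (\<forall>x\<in>{0..1 - \<delta> + A * \<delta>}. \<phi> i x = L) \<and>
          (\<forall>x\<in>{1 - \<delta> + A * \<delta>..1}.
            \<phi> i x = \<alpha> / (real k * \<delta>) * (real m * L * \<delta> + integral {0..\<delta> - 1 + x} (\<phi> i)))) \<and>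
        (m + 2 \<le> i \<longrightarrow>
          (\<forall>x\<in>{0..1}.
            \<phi> i x = \<alpha> / (real k * \<delta>) *
              ((\<Sum>j=1..i - 1. integral {x..min 1 (x + \<delta>)} (\<phi> j)) +
               (\<Sum>j=1..i. integral {0..max 0 (\<delta> - 1 + x)} (\<phi> j)))))))"

end

theory Submission
  imports Defs
begin

text \<open>
  The equations give \<open>\<phi> (i + 1) 0 = \<phi> i 1\<close>, so the prices glue to one curve, and this curve is
  nondecreasing. Hence under any instance the numbers \<open>n R\<close> of units sold under the seeds \<open>R\<close> are
  interlaced: \<open>n R' \<le> n R \<le> n R' + 1\<close> for \<open>R \<le> R'\<close>. In the end the seeds below some \<open>x\<close> have sold
  \<open>i\<close> units and those above \<open>x\<close> have sold \<open>i - 1\<close>. With \<open>w = \<phi> i x\<close>, all seeds have collected the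
  excess \<open>E\<close> of the values over \<open>w\<close> on top of the prices of the units sold, whereas the optimum is at
  most \<open>k w + E\<close>. Unless every buyer was served, \<open>(i, x)\<close> lies beyond the part of the curve where the
  price is constantly \<open>L\<close>, and there the integral equation says precisely that the conditional value
  at risk of the collected prices is \<open>k w / \<alpha>\<close>. Equality is approached by \<open>k\<close> copies of each value of a fine
  increasing grid from \<open>L\<close> to \<open>U\<close>: every unit is then sold at about its price, and the seeds in
  \<open>[0, \<delta>]\<close> show that the conditional value at risk is at most about \<open>k U / \<alpha>\<close>.
\<close>

subsection \<open>The selling process\<close>

text \<open>\<open>q j\<close> is the price of the \<open>j\<close>-th unit. The prices of
  \<open>cPPM\<close> depend on the history only through the number of units sold, so that number
  alone serves as the state.\<close>

primrec sold :: "nat \<Rightarrow> (nat \<Rightarrow> real) \<Rightarrow> (nat \<Rightarrow> real) \<Rightarrow> nat \<Rightarrow> nat" where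
  "sold k q v 0 = 0"
| "sold k q v (Suc t) =
     sold k q v t + of_bool (sold k q v t < k \<and> q (Suc (sold k q v t)) \<le> v t)"

abbreviation buys :: "nat \<Rightarrow> (nat \<Rightarrow> real) \<Rightarrow> (nat \<Rightarrow> real) \<Rightarrow> nat \<Rightarrow> bool" where
  "buys k q v t \<equiv> sold k q v t < k \<and> q (Suc (sold k q v t)) \<le> v t"

lemma sold_cong: "(\<And>s. s < t \<Longrightarrow> v s = v' s) \<Longrightarrow> sold k q v t = sold k q v' t"
  by (induction t) auto

lemma sold_mono: "s \<le> t \<Longrightarrow> sold k q v s \<le> sold k q v t"
  by (rule lift_Suc_mono_le[of "sold k q v"]) auto

lemma sold_le: "sold k q v t \<le> k"
  by (induction t) auto

lemma sold_le_time: "sold k q v t \<le> t"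
  by (induction t) auto

text \<open>Each buyer contributes at most one sale, so \<open>T\<close> sales among
  \<open>T\<close> buyers leave no room for a refusal.\<close>

lemma buys_of_sold_eq_time:
  assumes "sold k q v T = T" "t < T"
  shows "buys k q v t"
proof -
  have *: "sold k q v T \<le> sold k q v s + (T - s)" if "s \<le> T" for s
    using that by (induction T) (auto simp: le_Suc_eq Suc_diff_le)
  have "sold k q v (Suc t) = Suc t"
    using *[of "Suc t"] sold_le_time[of k q v "Suc t"] assms by simp
  then show ?thesis
    using sold_le_time[of k q v t] by (cases "buys k q v t") auto
qed


text \<open>Induction over the buyers. While the counts agree, the lower price sells whenever the
  higher one does. While \<open>q\<close> is one sale ahead, its next price is at least the one
  posted by \<open>q'\<close>, so the gap cannot widen.\<close>

lemma sold_interlace: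
  assumes "\<And>j. 1 \<le> j \<Longrightarrow> j \<le> k \<Longrightarrow> q j \<le> q' j"
    and "\<And>j. 1 \<le> j \<Longrightarrow> j < k \<Longrightarrow> q' j \<le> q (Suc j)"
  shows "sold k q' v t \<le> sold k q v t \<and> sold k q v t \<le> Suc (sold k q' v t)"
proof (induction t)
  case (Suc t)
  let ?a = "sold k q v t" and ?b = "sold k q' v t"
  consider "?a = ?b" | "?a = Suc ?b" using Suc.IH by linarith
  then show ?case
  proof cases
    case 1
    then show ?thesis using assms(1)[of "Suc ?a"] by auto
  next
    case 2
    then have "?b < k" using sold_le[of k q v t] by simp
    moreover have "?a < k \<Longrightarrow> q' ?a \<le> q (Suc ?a)" using assms(2)[of ?a] 2 by simp
    ultimately show ?thesis using 2 by auto
  qed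
qed simp

text \<open>Each sold unit has exactly one moment of sale; re-indexing by it turns sums over units
  into sums over buyers.\<close>

lemma sum_sold:
  "(\<Sum>j=1..sold k q v T. f j :: real) = (\<Sum>t<T. of_bool (buys k q v t) * f (Suc (sold k q v t)))"
  by (induction T) auto

text \<open>A sale at a value above \<open>w\<close> yields its price, which is at most \<open>w\<close>, plus the excess over \<open>w\<close>.\<close>

lemma welfare_ge:
  assumes buys: "\<And>t. t < T \<Longrightarrow> w < v t \<Longrightarrow> buys k q v t"
    and le: "\<And>j. 1 \<le> j \<Longrightarrow> j \<le> sold k q v T \<Longrightarrow> q j \<le> w"
  shows "(\<Sum>t<T. max (v t - w) 0) + (\<Sum>j=1..sold k q v T. q j) \<le>
    (\<Sum>t<T. v t * of_bool (buys k q v t))"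
proof -
  have "max (v t - w) 0 + of_bool (buys k q v t) * q (Suc (sold k q v t)) \<le>
      v t * of_bool (buys k q v t)" if "t < T" for t
  proof (cases "buys k q v t")
    case True
    then have "Suc (sold k q v t) = sold k q v (Suc t)" by simp
    also have "\<dots> \<le> sold k q v T" using that by (intro sold_mono) simp
    finally have "q (Suc (sold k q v t)) \<le> w" by (intro le) auto
    with True show ?thesis by auto
  next
    case False
    with buys[OF that] have "v t \<le> w" by force
    with False show ?thesis by auto
  qed
  then show ?thesis
    unfolding sum_sold sum.distrib[symmetric] by (intro sum_mono) auto
qed

section \<open>From decision lists to sale counts, and a bound on the optimum\<close>

lemma decisions_from_snoc:
  "decisions_from k p h (I @ [v]) =
    (let d = decisions_from k p h I in d @ [count_list d True < k \<and> p d \<le> v])"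
  by (induction I arbitrary: h) (auto simp: Let_def)

lemma decisions_snoc:
  "decisions k p (I @ [v]) =
    decisions k p I @ [count_list (decisions k p I) True < k \<and> p (decisions k p I) \<le> v]"
  by (simp add: decisions_def decisions_from_snoc Let_def)

lemma length_decisions: "length (decisions k p I) = length I"
  by (induction I rule: rev_induct) (simp_all add: decisions_snoc, simp add: decisions_def)

lemma count_decisions:
  "count_list (decisions k (cPPM \<phi> R) I) True = sold k (\<lambda>j. \<phi> j R) (nth I) (length I)"
proof (induction I rule: rev_induct)
  case (snoc v I)
  have "sold k (\<lambda>j. \<phi> j R) (nth (I @ [v])) (length I) = sold k (\<lambda>j. \<phi> j R) (nth I) (length I)"
    by (rule sold_cong) (simp add: nth_append)
  with snoc show ?case by (simp add: decisions_snoc cPPM_def)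
qed (simp add: decisions_def)

lemma ALG_cPPM:
  "ALG k (cPPM \<phi> R) I = (\<Sum>t<length I. I ! t * of_bool (buys k (\<lambda>j. \<phi> j R) (nth I) t))"
proof (induction I rule: rev_induct)
  case (snoc v I)
  have *: "sold k (\<lambda>j. \<phi> j R) (nth (I @ [v])) t = sold k (\<lambda>j. \<phi> j R) (nth I) t" if "t \<le> length I" for t
    using that by (intro sold_cong) (simp add: nth_append)
  have "ALG k (cPPM \<phi> R) (I @ [v]) =
      ALG k (cPPM \<phi> R) I + v * of_bool (buys k (\<lambda>j. \<phi> j R) (nth (I @ [v])) (length I))"
    by (simp add: ALG_def decisions_snoc nth_append length_decisions count_decisions *)
      (simp add: cPPM_def count_decisions)
  also have "\<dots> = (\<Sum>t<length (I @ [v]). (I @ [v]) ! t * of_bool (buys k (\<lambda>j. \<phi> j R) (nth (I @ [v])) t))"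
    unfolding snoc by (simp add: nth_append *)
  finally show ?case .
qed (simp add: ALG_def)

text \<open>An entry is at most \<open>w\<close> plus its excess over \<open>w\<close>, and the
  excesses of the entries not taken are nonnegative. For lists shorter than \<open>k\<close> the
  missing entries cost nothing because \<open>0 \<le> w\<close>.\<close>

lemma sum_list_take_le:
  assumes "0 \<le> (w::real)"
  shows "sum_list (take k xs) \<le> real k * w + (\<Sum>x\<leftarrow>xs. max (x - w) 0)"
proof (induction xs arbitrary: k)
  case (Cons x xs)
  show ?case
  proof (cases k)
    case 0
    have "0 \<le> (\<Sum>x\<leftarrow>xs. max (x - w) 0)" by (rule sum_list_nonneg) auto
    with 0 show ?thesis by simp
  next
    case (Suc k')
    with Cons.IH[of k'] show ?thesis by (auto simp: algebra_simps)
  qed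
qed (use assms in simp)

lemma OPT_le:
  assumes "0 \<le> w"
  shows "OPT k I \<le> real k * w + (\<Sum>t<length I. max (I ! t - w) 0)"
proof -
  have "(\<Sum>x\<leftarrow>rev (sort I). max (x - w) 0) = (\<Sum>x\<leftarrow>I. max (x - w) 0)"
    by (subst (1 2) sum_mset_sum_list[symmetric]) simp
  also have "\<dots> = (\<Sum>t<length I. max (I ! t - w) 0)"
    by (simp add: sum_list_sum_nth atLeast0LessThan)
  finally show ?thesis
    unfolding OPT_def using sum_list_take_le[OF assms, of k "rev (sort I)"] by simp
qed

subsection \<open>Conditional value at risk over the unit interval\<close>

lemma set_integral_Icc:
  fixes f :: "real \<Rightarrow> real"
  assumes "continuous_on {0..1} f" "{a..b} \<subseteq> {0..1}"
  shows "integrable lborel (\<lambda>x. indicator {a..b} x * f x)"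
    and "(\<integral>x. indicator {a..b} x * f x \<partial>lborel) = integral {a..b} f"
proof -
  have c: "continuous_on {a..b} f" using assms continuous_on_subset by blast
  note i = borel_integrable_atLeastAtMost'[OF c]
  show "integrable lborel (\<lambda>x. indicator {a..b} x * f x)"
    using i by (simp add: set_integrable_def)
  show "(\<integral>x. indicator {a..b} x * f x \<partial>lborel) = integral {a..b} f"
    using set_borel_integral_eq_integral(2)[OF i] by (simp add: set_lebesgue_integral_def)
qed

lemma integral_unit_seed: "(\<integral>x. f x \<partial>unit_seed) = (\<integral>x. indicator {0..1} x * (f x :: real) \<partial>lborel)"
  unfolding unit_seed_def by (subst integral_restrict_space) auto

text \<open>A single \<open>\<tau>\<close> bounds the supremum from below. Once the shortfall is
  dominated on intervals of total length \<open>\<delta>\<close>, \<open>\<tau>\<close> cancels. Two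
  intervals occur because a window of seeds modulo 1 may wrap around; \<open>N\<close> absorbs
  exceptional end points.\<close>

lemma CVaR_unit_seed_ge:
  assumes "0 < \<delta>" and f: "continuous_on {0..1} f" and g: "continuous_on {0..1} g"
    and ab: "a \<le> b" "{a..b} \<subseteq> {0..1}" and cd: "c \<le> d" "{c..d} \<subseteq> {0..1}"
    and \<delta>: "(b - a) + (d - c) = \<delta>" and "finite N"
    and le: "\<And>R. R \<in> {0..1} - N \<Longrightarrow> max (\<tau> - X R) 0 \<le>
      of_bool (R \<in> {a..b}) * (\<tau> - f R) + of_bool (R \<in> {c..d}) * (\<tau> - g R)"
  shows "ereal ((integral {a..b} f + integral {c..d} g) / \<delta>) \<le> CVaR \<delta> unit_seed X"
proof -
  let ?h = "\<lambda>R. indicator {a..b} R * (\<tau> - f R) + indicator {c..d} R * (\<tau> - g R)"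
  have ct: "continuous_on {0..1} (\<lambda>R. \<tau> - f R)" "continuous_on {0..1} (\<lambda>R. \<tau> - g R)"
    using f g by (auto intro!: continuous_intros)
  have fi: "f integrable_on {a..b}" "g integrable_on {c..d}"
    using f g ab cd by (auto intro!: integrable_continuous_real intro: continuous_on_subset)
  have N: "AE R in lborel. R \<notin> N"
    using \<open>finite N\<close> by (intro AE_not_in finite_imp_null_set_lborel)
  have le': "indicator {0..1} R * max (\<tau> - X R) 0 \<le> ?h R \<and> 0 \<le> ?h R" if "R \<notin> N" for R
  proof (cases "R \<in> {0..1}")
    case True
    with le[of R] that have "max (\<tau> - X R) 0 \<le> ?h R" by (auto simp: indicator_def)
    with True show ?thesis by auto
  next
    case False
    then have "R \<notin> {a..b}" "R \<notin> {c..d}" using ab cd by blast+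
    then have "indicator {a..b} R = (0::real)" "indicator {c..d} R = (0::real)" by simp_all
    with False show ?thesis by simp
  qed
  have "(\<integral>R. max (\<tau> - X R) 0 \<partial>unit_seed) \<le> (\<integral>R. ?h R \<partial>lborel)"
    unfolding integral_unit_seed
  \<comment> \<open>Only \<open>?h\<close> has to be integrable: a non-integrable left side has
    integral 0 by convention, and \<open>?h\<close> is nonnegative.\<close>
  proof (rule integral_mono_AE')
    show "integrable lborel ?h"
      using set_integral_Icc(1)[OF ct(1) ab(2)] set_integral_Icc(1)[OF ct(2) cd(2)] by simp
  qed (use N le' in auto)
  also have "\<dots> = integral {a..b} (\<lambda>R. \<tau> - f R) + integral {c..d} (\<lambda>R. \<tau> - g R)"
    using set_integral_Icc[OF ct(1) ab(2)] set_integral_Icc[OF ct(2) cd(2)] by simp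
  also have "\<dots> = \<tau> * \<delta> - (integral {a..b} f + integral {c..d} g)"
  proof -
    have "integral {a..b} (\<lambda>R. \<tau> - f R) = \<tau> * (b - a) - integral {a..b} f"
      using fi(1) ab(1) by (subst integral_diff) auto
    moreover have "integral {c..d} (\<lambda>R. \<tau> - g R) = \<tau> * (d - c) - integral {c..d} g"
      using fi(2) cd(1) by (subst integral_diff) auto
    ultimately show ?thesis unfolding \<delta>[symmetric] by (simp add: algebra_simps)
  qed
  finally have "(\<integral>R. max (\<tau> - X R) 0 \<partial>unit_seed) / \<delta> \<le>
      (\<tau> * \<delta> - (integral {a..b} f + integral {c..d} g)) / \<delta>"
    using \<open>0 < \<delta>\<close> by (intro divide_right_mono) auto
  then have "(integral {a..b} f + integral {c..d} g) / \<delta> \<le>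
      \<tau> - 1 / \<delta> * (\<integral>R. max (\<tau> - X R) 0 \<partial>unit_seed)"
    using \<open>0 < \<delta>\<close> by (simp add: diff_divide_distrib)
  then show ?thesis
    unfolding CVaR_def by (intro SUP_upper2[of \<tau>]) auto
qed

text \<open>For every \<open>\<tau>\<close> the shortfall is at least \<open>\<tau> - f R\<close> on
  \<open>{0..\<delta>}\<close> and at least 0 elsewhere, so \<open>\<tau>\<close> cancels again.
  \<open>X\<close> and \<open>bnd\<close> ensure integrability; otherwise the integral would be 0 by
  convention and the estimate could fail.\<close>

lemma CVaR_unit_seed_le:
  assumes "0 < \<delta>" "\<delta> \<le> 1" and f: "continuous_on {0..1} f"
    and X: "X \<in> borel_measurable unit_seed" and bnd: "\<And>R. \<bar>X R\<bar> \<le> B"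
    and le: "\<And>R. R \<in> {0..\<delta>} \<Longrightarrow> X R \<le> f R"
  shows "CVaR \<delta> unit_seed X \<le> ereal (integral {0..\<delta>} f / \<delta>)"
proof -
  interpret prob_space unit_seed by (rule prob_space_unit_seed)
  have "\<tau> - 1 / \<delta> * (\<integral>R. max (\<tau> - X R) 0 \<partial>unit_seed) \<le> integral {0..\<delta>} f / \<delta>" for \<tau>
  proof -
    have "integrable unit_seed (\<lambda>R. max (\<tau> - X R) 0)"
    proof (rule integrable_const_bound[where B = "\<bar>\<tau>\<bar> + B"])
      show "AE R in unit_seed. norm (max (\<tau> - X R) 0) \<le> \<bar>\<tau>\<bar> + B"
      proof (rule AE_I2)
        show "norm (max (\<tau> - X R) 0) \<le> \<bar>\<tau>\<bar> + B" for R using bnd[of R] by auto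
      qed
    qed (use X in measurable)
    then have int: "integrable lborel (\<lambda>R. indicator {0..1} R * max (\<tau> - X R) 0)"
      unfolding unit_seed_def by (subst (asm) integrable_restrict_space) auto
    have ct: "continuous_on {0..1} (\<lambda>R. \<tau> - f R)" using f by (auto intro!: continuous_intros)
    have fi: "f integrable_on {0..\<delta>}"
      using f assms(1,2) by (auto intro!: integrable_continuous_real intro: continuous_on_subset)
    have sub: "{0..\<delta>} \<subseteq> {0..1}" using assms(2) by auto
    have "\<tau> * \<delta> - integral {0..\<delta>} f = integral {0..\<delta>} (\<lambda>R. \<tau> - f R)"
      using fi \<open>0 < \<delta>\<close> by (subst integral_diff) auto
    also have "\<dots> = (\<integral>R. indicator {0..\<delta>} R * (\<tau> - f R) \<partial>lborel)"
      using set_integral_Icc(2)[OF ct sub] by simp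
    also have "\<dots> \<le> (\<integral>R. max (\<tau> - X R) 0 \<partial>unit_seed)"
      unfolding integral_unit_seed
    proof (rule integral_mono)
      fix R show "indicator {0..\<delta>} R * (\<tau> - f R) \<le> indicator {0..1} R * max (\<tau> - X R) 0"
        using le[of R] assms(2) by (auto simp: indicator_def)
    qed (use set_integral_Icc(1)[OF ct sub] int in auto)
    finally have "(\<tau> * \<delta> - integral {0..\<delta>} f) / \<delta> \<le> (\<integral>R. max (\<tau> - X R) 0 \<partial>unit_seed) / \<delta>"
      using \<open>0 < \<delta>\<close> by (intro divide_right_mono) auto
    then show ?thesis using \<open>0 < \<delta>\<close> by (simp add: diff_divide_distrib)
  qed
  then show ?thesis unfolding CVaR_def by (intro SUP_least) auto
qed

text \<open>Continuous induction: at the least point where \<open>f\<close> is at most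
  \<open>C\<close>, the step applies and gives a contradiction. It suits equations in which the
  value at a point involves earlier values of the same function.\<close>

lemma real_induct_unit_interval:
  fixes f :: "real \<Rightarrow> real"
  assumes f: "continuous_on {0..1} f" and "C < f 0"
    and step: "\<And>z. z \<in> {0..1} \<Longrightarrow> (\<And>y. y \<in> {0..z} \<Longrightarrow> C \<le> f y) \<Longrightarrow> C < f z"
    and "x \<in> {0..1}"
  shows "C < f x"
proof (rule ccontr)
  assume "\<not> C < f x"
  let ?Z = "{z \<in> {0..1}. f z \<le> C}"
  have "closed ?Z"
    using f by (intro continuous_on_closed_Collect_le continuous_intros) auto
  moreover have "bounded ?Z" by (rule bounded_subset[of "{0..1}"]) auto
  ultimately have "compact ?Z" by (simp add: compact_eq_bounded_closed)
  moreover have "x \<in> ?Z" using \<open>\<not> C < f x\<close> assms(4) by auto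
  ultimately obtain z where z: "z \<in> ?Z" "\<And>y. y \<in> ?Z \<Longrightarrow> z \<le> y"
    using compact_attains_inf[of ?Z] by auto
  \<comment> \<open>The step also wants the bound at \<open>z\<close> itself. If \<open>f z\<close>
    were below \<open>C\<close>, the value \<open>C\<close> would be taken before \<open>z\<close>,
    against minimality.\<close>
  have "C \<le> f z"
  proof (rule ccontr)
    assume "\<not> C \<le> f z"
    then obtain y where "0 \<le> y" "y \<le> z" "f y = C"
      using IVT2'[of f z C 0] \<open>C < f 0\<close> z(1) continuous_on_subset[OF f, of "{0..z}"] by force
    with z(1) z(2)[of y] \<open>\<not> C \<le> f z\<close> show False by auto
  qed
  moreover have "C \<le> f y" if "y \<in> {0..<z}" for y
    using z(2)[of y] z(1) that by force
  ultimately have "C < f z"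
    using z(1) by (intro step) (auto simp: le_less)
  with z(1) show False by simp
qed

subsection \<open>Monotonicity of the prices\<close>

locale pricing =
  fixes k :: nat and L \<delta> \<alpha> :: real and \<phi> :: "nat \<Rightarrow> real \<Rightarrow> real"
  assumes L_pos: "0 < L" and k_pos: "1 \<le> k" and \<delta>_pos: "0 < \<delta>" and \<delta>_le: "\<delta> \<le> 1"
    and \<alpha>_ge: "1 \<le> \<alpha>" and equations: "pricing_equations \<delta> k L \<alpha> \<phi>"
begin

definition m :: nat where "m = nat \<lfloor>real k / \<alpha>\<rfloor>"

definition flat_end :: real where "flat_end = 1 - \<delta> + (real k / \<alpha> - real m) * \<delta>"

text \<open>\<open>k / \<alpha> - m\<close> is a fractional part. Since
  \<open>1 - \<delta> \<le> flat_end\<close>, beyond the flat part the window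
  \<open>[x, x + \<delta>]\<close> always reaches 1.\<close>

lemma flat_end_bounds: "1 - \<delta> \<le> flat_end" "flat_end < 1" "0 \<le> flat_end"
proof -
  have *: "0 \<le> real k / \<alpha>" using \<alpha>_ge by simp
  then have "real m = of_int \<lfloor>real k / \<alpha>\<rfloor>" unfolding m_def by simp
  then have A: "0 \<le> real k / \<alpha> - real m" "real k / \<alpha> - real m < 1" by linarith+
  from A(1) show "1 - \<delta> \<le> flat_end" unfolding flat_end_def using \<delta>_pos by simp
  then show "0 \<le> flat_end" using \<delta>_le by simp
  from A(2) have "(real k / \<alpha> - real m) * \<delta> < 1 * \<delta>" using \<delta>_pos by (intro mult_strict_right_mono)
  then show "flat_end < 1" unfolding flat_end_def by simp
qed

lemma equations_at:
  assumes "i \<in> {1..k}"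
  shows "continuous_on {0..1} (\<phi> i)"
    and "i \<le> m \<Longrightarrow> \<forall>x\<in>{0..1}. \<phi> i x = L"
    and "i = Suc m \<Longrightarrow> \<forall>x\<in>{0..flat_end}. \<phi> i x = L"
    and "i = Suc m \<Longrightarrow> \<forall>x\<in>{flat_end..1}. \<phi> i x =
      \<alpha> / (real k * \<delta>) * (real m * L * \<delta> + integral {0..\<delta> - 1 + x} (\<phi> i))"
    and "m + 2 \<le> i \<Longrightarrow> \<forall>x\<in>{0..1}. \<phi> i x = \<alpha> / (real k * \<delta>) *
      ((\<Sum>j=1..i - 1. integral {x..min 1 (x + \<delta>)} (\<phi> j)) +
       (\<Sum>j=1..i. integral {0..max 0 (\<delta> - 1 + x)} (\<phi> j)))"
  using equations[unfolded pricing_equations_def Let_def, folded m_def, folded flat_end_def,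
      THEN conjunct1, THEN bspec, OF assms]
    equations[unfolded pricing_equations_def Let_def, folded m_def, folded flat_end_def,
      THEN conjunct2, THEN bspec, OF assms]
  by (simp_all only: Suc_eq_plus1 simp_thms) (elim conjE, assumption)+

lemma continuous_price: "1 \<le> i \<Longrightarrow> i \<le> k \<Longrightarrow> continuous_on {0..1} (\<phi> i)"
  using equations_at(1)[of i] by simp

lemma price_integrable: "1 \<le> i \<Longrightarrow> i \<le> k \<Longrightarrow> {x..y} \<subseteq> {0..1} \<Longrightarrow> \<phi> i integrable_on {x..y}"
  by (meson continuous_price continuous_on_subset integrable_continuous_real)

lemma price_eq_L:
  assumes "1 \<le> i" "i \<le> k" "x \<in> {0..1}" "i \<le> m \<or> i = Suc m \<and> x \<le> flat_end"
  shows "\<phi> i x = L"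
  using equations_at(2,3)[of i] assms by auto

text \<open>Beyond the flat part, level \<open>Suc m\<close> obeys the general equation as well: the
  lower levels are constantly \<open>L\<close> and the two arcs of the window have total length
  \<open>\<delta>\<close>, which accounts for \<open>m * L * \<delta>\<close>.\<close>

lemma price_eq:
  assumes i: "1 \<le> i" "i \<le> k" "m < i" and x: "x \<in> {0..1}" and flat_end: "i = Suc m \<Longrightarrow> flat_end \<le> x"
  shows "\<phi> i x = \<alpha> / (real k * \<delta>) *
    ((\<Sum>j=1..i - 1. integral {x..min 1 (x + \<delta>)} (\<phi> j)) +
     (\<Sum>j=1..i. integral {0..max 0 (\<delta> - 1 + x)} (\<phi> j)))"
proof (cases "i = Suc m")
  case True
  then have bx: "flat_end \<le> x" by (rule flat_end)
  have L: "integral {u..v} (\<phi> j) = (v - u) * L" if "j \<in> {1..m}" "0 \<le> u" "u \<le> v" "v \<le> 1" for u v j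
  proof -
    have "integral {u..v} (\<phi> j) = integral {u..v} (\<lambda>_. L)"
      using that i True by (intro integral_cong price_eq_L) auto
    then show ?thesis using that by simp
  qed
  have 1: "min 1 (x + \<delta>) = 1" "max 0 (\<delta> - 1 + x) = \<delta> - 1 + x" using bx flat_end_bounds by auto
  let ?S = "\<lambda>u v. \<Sum>j=1..m. integral {u..v} (\<phi> j)"
  have "?S x 1 = (\<Sum>j=1..m. (1 - x) * L)"
    using x by (intro sum.cong refl L) auto
  moreover have "?S 0 (\<delta> - 1 + x) = (\<Sum>j=1..m. (\<delta> - 1 + x - 0) * L)"
    using x bx flat_end_bounds \<delta>_le by (intro sum.cong refl L) auto
  ultimately have S: "?S x 1 + ?S 0 (\<delta> - 1 + x) = real m * L * \<delta>"
    by (simp add: algebra_simps)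
  have "\<phi> i x = \<alpha> / (real k * \<delta>) * (real m * L * \<delta> + integral {0..\<delta> - 1 + x} (\<phi> i))"
    using i x bx by (intro equations_at(4)[OF _ True, THEN bspec]) auto
  also have "\<dots> = \<alpha> / (real k * \<delta>) *
      (?S x 1 + (\<Sum>j=1..Suc m. integral {0..\<delta> - 1 + x} (\<phi> j)))"
    unfolding S[symmetric] True by (simp add: add.assoc)
  finally show ?thesis unfolding 1 by (simp add: True)
next
  case False
  then show ?thesis
    using i x by (intro equations_at(5)[THEN bspec]) auto
qed

lemma price_1_0: "\<phi> 1 0 = L"
  using k_pos flat_end_bounds by (intro price_eq_L) auto

lemma price_at_1:
  assumes "1 \<le> i" "i \<le> k" "m < i"
  shows "\<phi> i 1 = \<alpha> / (real k * \<delta>) * (\<Sum>j=1..i. integral {0..\<delta>} (\<phi> j))"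
  using assms flat_end_bounds \<delta>_pos by (subst price_eq) auto

text \<open>Past the flat part, both values integrate the levels \<open>1..i\<close> over
  \<open>[0, \<delta>]\<close>; otherwise both are \<open>L\<close>.\<close>

lemma price_Suc_0:
  assumes "1 \<le> i" "i < k"
  shows "\<phi> (Suc i) 0 = \<phi> i 1"
proof -
  consider "Suc i \<le> m" | "i = m" | "m < i" by linarith
  then show ?thesis
  proof cases
    case 3
    have "\<phi> (Suc i) 0 = \<alpha> / (real k * \<delta>) * (\<Sum>j=1..i. integral {0..\<delta>} (\<phi> j))"
      using 3 assms \<delta>_pos \<delta>_le by (subst price_eq) auto
    with 3 assms show ?thesis by (simp add: price_at_1)
  qed (use assms price_eq_L[of i 1] price_eq_L[of "Suc i" 0] flat_end_bounds in auto)
qed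

text \<open>Telescoping through \<open>price_Suc_0\<close>. The identity drives the cancellation
  behind monotonicity and the comparison of seeds that sell \<open>i\<close> units with seeds that
  sell \<open>i - 1\<close>.\<close>

lemma sum_price_1:
  assumes "1 \<le> i" "i \<le> k"
  shows "(\<Sum>j=1..i - 1. \<phi> j 1) + L = (\<Sum>j=1..i. \<phi> j 0)"
  using assms
proof (induction i rule: dec_induct)
  case base
  then show ?case using price_1_0 by simp
next
  case (step n)
  then have "(\<Sum>j=1..n. \<phi> j 1) = (\<Sum>j=1..n - 1. \<phi> j 1) + \<phi> n 1"
    by (cases n) auto
  with step show ?case by (simp add: price_Suc_0)
qed

lemma coeff_pos: "0 < \<alpha> / (real k * \<delta>)"
  using \<alpha>_ge k_pos \<delta>_pos by simp

lemma integral_price_diff: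
  assumes "1 \<le> j" "j \<le> k" "0 \<le> u" "u \<le> v" "v \<le> w" "w \<le> 1"
  shows "integral {u..w} (\<phi> j) = integral {u..v} (\<phi> j) + integral {v..w} (\<phi> j)"
  using Henstock_Kurzweil_Integration.integral_combine[of u v w "\<phi> j"]
    price_integrable[of j u w] assms by auto

lemma integral_price_le:
  assumes "1 \<le> j" "j \<le> k" "0 \<le> u" "u \<le> v" "v \<le> 1" "\<And>x. x \<in> {u..v} \<Longrightarrow> \<phi> j x \<le> C"
  shows "integral {u..v} (\<phi> j) \<le> (v - u) * C"
  using integral_le[of "\<phi> j" "{u..v}" "\<lambda>_. C"] price_integrable[of j u v] assms by auto

lemma integral_price_ge:
  assumes "1 \<le> j" "j \<le> k" "0 \<le> u" "u \<le> v" "v \<le> 1" "\<And>x. x \<in> {u..v} \<Longrightarrow> C \<le> \<phi> j x"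
  shows "(v - u) * C \<le> integral {u..v} (\<phi> j)"
  using integral_le[of "\<lambda>_. C" "{u..v}" "\<phi> j"] price_integrable[of j u v] assms by auto

text \<open>
  The integral equation expresses \<open>\<phi> i x' - \<phi> i x\<close> by integrals over short intervals; bounding these
  by the boundary values of the prices, everything cancels because of \<open>sum_price_1\<close>.
\<close>

lemma price_le_of_lower_bound:
  assumes i: "1 \<le> i" "i \<le> k" "m < i"
    and mono: "\<And>j. 1 \<le> j \<Longrightarrow> j < i \<Longrightarrow> mono_on {0..1} (\<phi> j)"
    and x: "1 - \<delta> \<le> x" "x \<le> x'" "x' \<le> 1" "i = Suc m \<Longrightarrow> flat_end \<le> x"
    and lb: "\<And>y. y \<in> {0..x'} \<Longrightarrow> \<phi> i 0 - L \<le> \<phi> i y"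
  shows "\<phi> i x \<le> \<phi> i x'"
proof -
  have x0: "0 \<le> x" using x(1) \<delta>_le by simp
  have eq: "\<phi> i z = \<alpha> / (real k * \<delta>) *
     ((\<Sum>j=1..i - 1. integral {z..1} (\<phi> j)) + (\<Sum>j=1..i. integral {0..\<delta> - 1 + z} (\<phi> j)))"
    if "x \<le> z" "z \<le> 1" for z
    using that x i x0 by (subst price_eq) (auto simp: min_def max_def)
  have "(\<Sum>j=1..i - 1. integral {x..1} (\<phi> j)) - (\<Sum>j=1..i - 1. integral {x'..1} (\<phi> j)) =
      (\<Sum>j=1..i - 1. integral {x..x'} (\<phi> j))"
    unfolding sum_subtractf[symmetric] using x x0 i
    by (intro sum.cong refl) (auto simp: integral_price_diff[of _ x x' 1])
  also have "\<dots> \<le> (\<Sum>j=1..i - 1. (x' - x) * \<phi> j 1)"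
  proof (intro sum_mono integral_price_le)
    fix j y assume "j \<in> {1..i - 1}" "y \<in> {x..x'}"
    then show "\<phi> j y \<le> \<phi> j 1" using x x0 by (intro mono_onD[OF mono[of j]]) auto
  qed (use x x0 i in auto)
  also have "\<dots> = (x' - x) * (\<Sum>j=1..i - 1. \<phi> j 1)" by (simp add: sum_distrib_left)
  \<comment> \<open>End values of the lower levels become initial values; the remainder
    \<open>\<phi> i 0 - L\<close> is exactly the lower bound that \<open>lb\<close> grants on level
    \<open>i\<close>.\<close>
  also have "\<dots> = (x' - x) * ((\<Sum>j=1..i - 1. \<phi> j 0) + (\<phi> i 0 - L))"
  proof -
    have "(\<Sum>j=1..i. \<phi> j 0) = (\<Sum>j=1..i - 1. \<phi> j 0) + \<phi> i 0" using i(1) by (cases i) auto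
    with sum_price_1[OF i(1,2)] show ?thesis by simp
  qed
  also have "\<dots> = (\<Sum>j=1..i - 1. (x' - x) * \<phi> j 0) + (x' - x) * (\<phi> i 0 - L)"
    by (simp add: sum_distrib_left algebra_simps)
  also have "\<dots> \<le> (\<Sum>j=1..i - 1. integral {\<delta> - 1 + x..\<delta> - 1 + x'} (\<phi> j)) +
      integral {\<delta> - 1 + x..\<delta> - 1 + x'} (\<phi> i)"
  proof (intro add_mono sum_mono)
    fix j assume j: "j \<in> {1..i - 1}"
    have "(\<delta> - 1 + x' - (\<delta> - 1 + x)) * \<phi> j 0 \<le> integral {\<delta> - 1 + x..\<delta> - 1 + x'} (\<phi> j)"
    proof (rule integral_price_ge)
      fix y assume "y \<in> {\<delta> - 1 + x..\<delta> - 1 + x'}"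
      then show "\<phi> j 0 \<le> \<phi> j y" using j x \<delta>_le by (intro mono_onD[OF mono[of j]]) auto
    qed (use x \<delta>_le i j in auto)
    then show "(x' - x) * \<phi> j 0 \<le> integral {\<delta> - 1 + x..\<delta> - 1 + x'} (\<phi> j)" by simp
  next
    have "(\<delta> - 1 + x' - (\<delta> - 1 + x)) * (\<phi> i 0 - L) \<le> integral {\<delta> - 1 + x..\<delta> - 1 + x'} (\<phi> i)"
      using x \<delta>_le i by (intro integral_price_ge lb) auto
    then show "(x' - x) * (\<phi> i 0 - L) \<le> integral {\<delta> - 1 + x..\<delta> - 1 + x'} (\<phi> i)" by simp
  qed
  also have "\<dots> = (\<Sum>j=1..i. integral {\<delta> - 1 + x..\<delta> - 1 + x'} (\<phi> j))"
    using i(1) by (cases i) auto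
  also have "\<dots> = (\<Sum>j=1..i. integral {0..\<delta> - 1 + x'} (\<phi> j)) - (\<Sum>j=1..i. integral {0..\<delta> - 1 + x} (\<phi> j))"
    unfolding sum_subtractf[symmetric] using x \<delta>_le i
    by (intro sum.cong refl) (auto simp: integral_price_diff[of _ 0 "\<delta> - 1 + x" "\<delta> - 1 + x'"])
  finally show ?thesis
    using eq[of x] eq[of x'] x coeff_pos by (simp del: times_divide_eq_left)
qed

text \<open>Here the price is constant, or it integrates lower levels over a window that does not
  wrap; shifting the window to the right increases the integral because the lower levels are
  nondecreasing.\<close>

lemma price_mono_start:
  assumes i: "1 \<le> i" "i \<le> k"
    and mono: "\<And>j. 1 \<le> j \<Longrightarrow> j < i \<Longrightarrow> mono_on {0..1} (\<phi> j)"
    and x: "0 \<le> x" "x \<le> x'" "x' \<le> (if i = Suc m then flat_end else 1 - \<delta>)"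
  shows "\<phi> i x \<le> \<phi> i x'"
proof -
  consider "i \<le> m" | "i = Suc m" | "Suc m < i" by linarith
  then show ?thesis
  proof cases
    case 3
    have eq: "\<phi> i z = \<alpha> / (real k * \<delta>) * (\<Sum>j=1..i - 1. integral {z..z + \<delta>} (\<phi> j))"
      if "0 \<le> z" "z \<le> 1 - \<delta>" for z
      using that 3 i \<delta>_pos by (subst price_eq) auto
    have "integral {x..x + \<delta>} (\<phi> j) \<le> integral {x'..x' + \<delta>} (\<phi> j)" if j: "j \<in> {1..i - 1}" for j
    proof -
      have sub: "{x'..x' + \<delta>} \<subseteq> {0..1}" using x 3 by auto
      have ct: "continuous_on {x + (x' - x)..x + \<delta> + (x' - x)} (\<phi> j)"
        using continuous_on_subset[OF continuous_price[of j]] j i sub by (auto simp: algebra_simps)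
      have "integral {x..x + \<delta>} (\<phi> j) \<le> integral {x..x + \<delta>} (\<phi> j \<circ> (\<lambda>y. y + (x' - x)))"
      proof (rule integral_le)
        show "\<phi> j integrable_on {x..x + \<delta>}" using j i x 3 by (intro price_integrable) auto
        have "continuous_on {x..x + \<delta>} (\<phi> j \<circ> (\<lambda>y. y + (x' - x)))"
          using ct by (intro continuous_on_compose continuous_intros) (auto simp: image_add_atLeastAtMost')
        then show "\<phi> j \<circ> (\<lambda>y. y + (x' - x)) integrable_on {x..x + \<delta>}"
          by (rule integrable_continuous_real)
        show "\<phi> j y \<le> (\<phi> j \<circ> (\<lambda>y. y + (x' - x))) y" if "y \<in> {x..x + \<delta>}" for y
          using that j x 3 unfolding comp_def by (intro mono_onD[OF mono[of j]]) auto
      qed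
      also have "\<dots> = integral {x'..x' + \<delta>} (\<phi> j)"
        using integral_shift[OF ct] by (simp add: algebra_simps)
      finally show ?thesis .
    qed
    then have "(\<Sum>j=1..i - 1. integral {x..x + \<delta>} (\<phi> j)) \<le> (\<Sum>j=1..i - 1. integral {x'..x' + \<delta>} (\<phi> j))"
      by (rule sum_mono)
    then show ?thesis
      using eq[of x] eq[of x'] x 3 coeff_pos by (simp del: times_divide_eq_left)
  qed (use i x price_eq_L[of i x] price_eq_L[of i x'] flat_end_bounds \<delta>_pos in auto)
qed

text \<open>Induction on the level. Up to \<open>a\<close> the price involves only lower levels.
  Beyond \<open>a\<close> level \<open>i\<close> enters its own equation, and its increments are
  controlled only given a lower bound on its earlier values.\<close>

lemma price_mono_on:
  assumes "1 \<le> i" "i \<le> k"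
  shows "mono_on {0..1} (\<phi> i)"
  using assms
proof (induction i rule: less_induct)
  case (less i)
  show ?case
  proof (cases "i \<le> m")
    case True
    then show ?thesis using less.prems by (auto intro!: mono_onI simp: price_eq_L)
  next
    case False
    define a where "a = (if i = Suc m then flat_end else 1 - \<delta>)"
    have a: "1 - \<delta> \<le> a" "0 \<le> a" "a \<le> 1" "i = Suc m \<Longrightarrow> flat_end \<le> a"
      using flat_end_bounds \<delta>_pos \<delta>_le by (auto simp: a_def)
    have IH: "mono_on {0..1} (\<phi> j)" if "1 \<le> j" "j < i" for j
      using less.IH[of j] that less.prems by simp
    note start = price_mono_start[OF less.prems IH, folded a_def]
    have up: "\<phi> i x \<le> \<phi> i x'"
      if "a \<le> x" "x \<le> x'" "x' \<le> 1" "\<And>y. y \<in> {0..x'} \<Longrightarrow> \<phi> i 0 - L \<le> \<phi> i y" for x x'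
      using that a False less.prems by (intro price_le_of_lower_bound IH) auto
    \<comment> \<open>The circularity is resolved by continuous induction: the bound
      \<open>\<phi> i 0 - L\<close> up to \<open>z\<close> yields the better bound
      \<open>\<phi> i 0\<close> at \<open>z\<close>, and \<open>L\<close> is positive.\<close>
    have lb: "\<phi> i 0 - L < \<phi> i z" if "z \<in> {0..1}" for z
    proof (rule real_induct_unit_interval[OF continuous_price[OF less.prems] _ _ that])
      fix z assume z: "z \<in> {0..1}" "\<And>y. y \<in> {0..z} \<Longrightarrow> \<phi> i 0 - L \<le> \<phi> i y"
      have "\<phi> i 0 \<le> \<phi> i z"
      proof (cases "z \<le> a")
        case True
        then show ?thesis using z by (intro start) auto
      next
        case False
        then have "\<phi> i 0 \<le> \<phi> i a" "\<phi> i a \<le> \<phi> i z" using z a by (simp add: start, intro up) auto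
        then show ?thesis by simp
      qed
      then show "\<phi> i 0 - L < \<phi> i z" using L_pos by simp
    qed (use L_pos in auto)
    show ?thesis
    proof (rule mono_onI)
      fix x x' :: real assume x: "x \<in> {0..1}" "x' \<in> {0..1}" "x \<le> x'"
      have up': "\<phi> i u \<le> \<phi> i u'" if "a \<le> u" "u \<le> u'" "u' \<le> 1" for u u'
        using that lb by (intro up) (auto simp: less_imp_le)
      consider "x' \<le> a" | "a \<le> x" | "x \<le> a" "a \<le> x'" by linarith
      then show "\<phi> i x \<le> \<phi> i x'"
      proof cases
        case 1 then show ?thesis using x by (intro start) auto
      next
        case 2 then show ?thesis using x by (intro up') auto
      next
        case 3
        then have "\<phi> i x \<le> \<phi> i a" "\<phi> i a \<le> \<phi> i x'" using x a by (intro start up'; simp)+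
        then show ?thesis by simp
      qed
    qed
  qed
qed

lemma price_mono:
  "1 \<le> i \<Longrightarrow> i \<le> k \<Longrightarrow> 0 \<le> x \<Longrightarrow> x \<le> y \<Longrightarrow> y \<le> 1 \<Longrightarrow> \<phi> i x \<le> \<phi> i y"
  by (rule mono_onD[OF price_mono_on]) auto

text \<open>Monotonicity within levels, chained with \<open>price_Suc_0\<close>, orders points of
  different levels whatever their seeds.\<close>

lemma price_le_next_level:
  assumes "1 \<le> i" "i < j" "j \<le> k" "x \<in> {0..1}" "y \<in> {0..1}"
  shows "\<phi> i x \<le> \<phi> j y"
  using assms(2,3,5)
proof (induction j arbitrary: y)
  case (Suc j)
  have "\<phi> i x \<le> \<phi> j 1"
  proof (cases "i = j")
    case True
    then show ?thesis using assms(1,4) Suc.prems by (auto intro!: price_mono)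
  next
    case False
    then show ?thesis using Suc.prems by (intro Suc.IH) auto
  qed
  also have "\<dots> = \<phi> (Suc j) 0" using Suc.prems assms(1) by (intro price_Suc_0[symmetric]) auto
  also have "\<dots> \<le> \<phi> (Suc j) y" using Suc.prems by (intro price_mono) auto
  finally show ?case .
qed simp

lemma price_le_level:
  assumes "1 \<le> i" "i \<le> j" "j \<le> k" "x \<in> {0..1}"
  shows "\<phi> i x \<le> \<phi> j x"
  using assms price_le_next_level[of i j x x] by (cases "i = j") auto

lemma price_ge_L:
  assumes "1 \<le> i" "i \<le> k" "x \<in> {0..1}"
  shows "L \<le> \<phi> i x"
proof -
  have "L \<le> \<phi> 1 x" using price_mono[of 1 0 x] price_1_0 k_pos assms by auto
  also have "\<dots> \<le> \<phi> i x" using assms by (intro price_le_level) auto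
  finally show ?thesis .
qed

end

subsection \<open>The guarantee\<close>

context pricing
begin

lemma integral_sum_price:
  assumes "i \<le> k" "u \<le> v" "{u..v} \<subseteq> {0..1}"
  shows "integral {u..v} (\<lambda>R. E + (\<Sum>j=1..i. \<phi> j R)) = (v - u) * E + (\<Sum>j=1..i. integral {u..v} (\<phi> j))"
proof -
  have i: "\<phi> j integrable_on {u..v}" if "j \<in> {1..i}" for j
    using that assms by (intro price_integrable) auto
  have "integral {u..v} (\<lambda>R. E + (\<Sum>j=1..i. \<phi> j R)) =
      integral {u..v} (\<lambda>R. E) + integral {u..v} (\<lambda>R. \<Sum>j=1..i. \<phi> j R)"
    using i by (intro integral_add integrable_sum) auto
  also have "integral {u..v} (\<lambda>R. \<Sum>j=1..i. \<phi> j R) = (\<Sum>j=1..i. integral {u..v} (\<phi> j))"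
    using i by (intro integral_sum) auto
  finally show ?thesis using assms by simp
qed

lemma continuous_sum_price: "i \<le> k \<Longrightarrow> continuous_on {0..1} (\<lambda>R. E + (\<Sum>j=1..i. \<phi> j R))"
  by (intro continuous_intros) (auto intro: continuous_price)

lemma sum_price_mono:
  assumes "i \<le> k" "0 \<le> x" "x \<le> y" "y \<le> 1"
  shows "(\<Sum>j=1..i. \<phi> j x) \<le> (\<Sum>j=1..i. \<phi> j y)"
  using assms by (intro sum_mono price_mono) auto

text \<open>
  The seeds in \<open>[x, x + \<delta>]\<close>, taken modulo \<open>1\<close>, carry the \<open>\<delta>\<close>-fraction of lowest welfare when the
  seeds below \<open>x\<close> sell \<open>i\<close> units and those above sell \<open>i - 1\<close>.
\<close>

lemma CVaR_ge_level:
  assumes i: "1 \<le> i" "i \<le> k" and x: "x \<in> {0..1}"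
    and below: "\<And>R. 0 \<le> R \<Longrightarrow> R < x \<Longrightarrow> E + (\<Sum>j=1..i. \<phi> j R) \<le> X R"
    and above: "\<And>R. x < R \<Longrightarrow> R \<le> 1 \<Longrightarrow> E + (\<Sum>j=1..i - 1. \<phi> j R) \<le> X R"
  shows "ereal (E + ((\<Sum>j=1..i - 1. integral {x..min 1 (x + \<delta>)} (\<phi> j)) +
     (\<Sum>j=1..i. integral {0..max 0 (\<delta> - 1 + x)} (\<phi> j))) / \<delta>) \<le> CVaR \<delta> unit_seed X"
proof -
  define e where "e = min 1 (x + \<delta>)"
  define d where "d = max 0 (\<delta> - 1 + x)"
  define F where "F = (\<lambda>R. \<Sum>j=1..i - 1. \<phi> j R)"
  define G where "G = (\<lambda>R. \<Sum>j=1..i. \<phi> j R)"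
  \<comment> \<open>The price total at the end of the window: with \<open>i - 1\<close> units at
    \<open>x + \<delta>\<close> if it does not wrap, and otherwise with \<open>i\<close> units at
    \<open>d\<close>.\<close>
  define \<tau> where "\<tau> = (if x + \<delta> \<le> 1 then F (x + \<delta>) else G d)"
  have F: "F u \<le> F v" if "0 \<le> u" "u \<le> v" "v \<le> 1" for u v
    unfolding F_def using that i by (intro sum_price_mono) auto
  have G: "G u \<le> G v" if "0 \<le> u" "u \<le> v" "v \<le> 1" for u v
    unfolding G_def using that i by (intro sum_price_mono) auto
  \<comment> \<open>Selling \<open>i\<close> units at the lowest prices still beats selling
    \<open>i - 1\<close> at the highest, so the poorest seeds start at \<open>x\<close>.\<close>
  have FG: "F u \<le> G v" if "0 \<le> u" "u \<le> 1" "0 \<le> v" "v \<le> 1" for u v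
  proof -
    have "F u \<le> F 1" using that by (intro F) auto
    also have "\<dots> \<le> G 0" using sum_price_1[OF i] L_pos by (simp add: F_def G_def)
    also have "\<dots> \<le> G v" using that by (intro G) auto
    finally show ?thesis .
  qed
  have bounds: "x \<le> e" "e \<le> 1" "0 \<le> d" "d \<le> x" "(e - x) + (d - 0) = \<delta>"
    using x \<delta>_pos \<delta>_le by (auto simp: e_def d_def min_def max_def)
  have "ereal ((integral {x..e} (\<lambda>R. E + F R) + integral {0..d} (\<lambda>R. E + G R)) / \<delta>) \<le> CVaR \<delta> unit_seed X"
  \<comment> \<open>Nothing is assumed about \<open>X\<close> at \<open>x\<close>. The seed 0 is
    exempt because \<open>{0..d}\<close> degenerates to it when the window does not wrap.\<close>
  proof (rule CVaR_unit_seed_ge[where N = "{0, x}" and \<tau> = "E + \<tau>"])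
    show "continuous_on {0..1} (\<lambda>R. E + F R)" "continuous_on {0..1} (\<lambda>R. E + G R)"
      unfolding F_def G_def using i by (simp_all only: continuous_sum_price diff_le_self le_trans[OF diff_le_self])
    fix R assume R: "R \<in> {0..1} - {0, x}"
    show "max (E + \<tau> - X R) 0 \<le> of_bool (R \<in> {x..e}) * (E + \<tau> - (E + F R)) +
        of_bool (R \<in> {0..d}) * (E + \<tau> - (E + G R))"
    proof (cases "R < x")
      case True
      then have X: "E + G R \<le> X R" using below[of R] R by (simp add: G_def)
      show ?thesis
      proof (cases "R \<le> d")
        case True
        then have "\<not> x + \<delta> \<le> 1" "G R \<le> G d" using R bounds x G by (auto simp: d_def)
        then have "G R \<le> \<tau>" by (simp add: \<tau>_def)
        with X True \<open>R < x\<close> R show ?thesis by auto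
      next
        case False
        have "\<tau> \<le> G R" using False bounds x R \<delta>_pos FG[of "x + \<delta>" R] G[of d R] by (auto simp: \<tau>_def)
        with X False \<open>R < x\<close> R show ?thesis by auto
      qed
    next
      case False
      with R have "x < R" by auto
      then have X: "E + F R \<le> X R" using above[of R] R by (simp add: F_def)
      show ?thesis
      proof (cases "R \<le> e")
        case True
        have "F R \<le> \<tau>"
          using True \<open>x < R\<close> bounds x R F[of R "x + \<delta>"] FG[of R d] by (auto simp: \<tau>_def e_def)
        with X True \<open>x < R\<close> bounds show ?thesis by auto
      next
        case False
        then have "x + \<delta> \<le> 1" "x + \<delta> \<le> R" using R by (auto simp: e_def)
        then have "\<tau> \<le> F R" using F[of "x + \<delta>" R] x \<delta>_pos R by (auto simp: \<tau>_def)
        with X False \<open>x < R\<close> bounds show ?thesis by auto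
      qed
    qed
  qed (use bounds x \<delta>_pos in auto)
  moreover have "integral {x..e} (\<lambda>R. E + F R) = (e - x) * E + (\<Sum>j=1..i - 1. integral {x..e} (\<phi> j))"
    unfolding F_def using i bounds x by (intro integral_sum_price) auto
  moreover have "integral {0..d} (\<lambda>R. E + G R) = (d - 0) * E + (\<Sum>j=1..i. integral {0..d} (\<phi> j))"
    unfolding G_def using i bounds x by (intro integral_sum_price) auto
  ultimately have "ereal (((e - x + (d - 0)) * E + ((\<Sum>j=1..i - 1. integral {x..e} (\<phi> j)) +
      (\<Sum>j=1..i. integral {0..d} (\<phi> j)))) / \<delta>) \<le> CVaR \<delta> unit_seed X"
    by (simp add: algebra_simps)
  then show ?thesis
    unfolding bounds(5) using \<delta>_pos by (simp add: e_def d_def add_divide_distrib)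
qed

lemma sold_interlace_seeds:
  assumes "0 \<le> R" "R \<le> R'" "R' \<le> 1"
  shows "sold k (\<lambda>j. \<phi> j R') v t \<le> sold k (\<lambda>j. \<phi> j R) v t"
    and "sold k (\<lambda>j. \<phi> j R) v t \<le> Suc (sold k (\<lambda>j. \<phi> j R') v t)"
  using sold_interlace[of k "\<lambda>j. \<phi> j R" "\<lambda>j. \<phi> j R'" v t] assms
  by (auto simp: price_mono price_le_next_level)

text \<open>
  A buyer accepting the last price \<open>\<phi> i R'\<close> or a lower one under a seed \<open>R'\<close> that never gets past
  this price accepts under all seeds, since no seed can be more than one sale ahead.
\<close>

lemma buys_under_all_seeds:
  assumes R: "R \<in> {0..1}" and R': "R' \<in> {0..1}" and "i \<le> k"
    and final: "sold k (\<lambda>j. \<phi> j R') v T < i" and t: "t < T" "\<phi> i R' \<le> v t"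
  shows "buys k (\<lambda>j. \<phi> j R) v t"
proof -
  let ?n = "\<lambda>R. sold k (\<lambda>j. \<phi> j R) v"
  have le: "?n R' s < i" if "s \<le> T" for s
    using sold_mono[OF that, of k "\<lambda>j. \<phi> j R'" v] final by simp
  have "\<phi> (Suc (?n R' t)) R' \<le> \<phi> i R'"
    using le[of t] t \<open>i \<le> k\<close> R' by (intro price_le_level) auto
  then have "buys k (\<lambda>j. \<phi> j R') v t" using le[of t] t \<open>i \<le> k\<close> by simp
  then have lt: "Suc (?n R' t) < i" using le[of "Suc t"] t by simp
  show ?thesis
  proof (cases "R \<le> R'")
    case True
    have n: "?n R t \<le> Suc (?n R' t)" using True R R' by (intro sold_interlace_seeds) auto
    then have "\<phi> (Suc (?n R t)) R \<le> \<phi> (Suc (?n R t)) R'"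
      using lt True R R' \<open>i \<le> k\<close> by (intro price_mono) auto
    also have "\<dots> \<le> \<phi> i R'" using lt n R' \<open>i \<le> k\<close> by (intro price_le_level) auto
    finally show ?thesis using lt n t \<open>i \<le> k\<close> by auto
  next
    case False
    then have n: "?n R t \<le> ?n R' t" using R R' by (intro sold_interlace_seeds) auto
    then have "\<phi> (Suc (?n R t)) R \<le> \<phi> i R'"
      using lt R R' \<open>i \<le> k\<close> by (intro price_le_next_level) auto
    then show ?thesis using lt n t \<open>i \<le> k\<close> by auto
  qed
qed

lemma CVaR_const:
  assumes "\<And>R. R \<in> {0..1} \<Longrightarrow> X R = C"
  shows "ereal C \<le> CVaR \<delta> unit_seed X"
proof -
  have "ereal ((integral {0..\<delta>} (\<lambda>_. C) + integral {0..0::real} (\<lambda>_. C)) / \<delta>) \<le> CVaR \<delta> unit_seed X"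
    by (rule CVaR_unit_seed_ge[where N = "{}" and \<tau> = C]) (use assms \<delta>_pos \<delta>_le in auto)
  then show ?thesis using \<delta>_pos by simp
qed

lemma OPT_nonneg: "I \<in> instances L U \<Longrightarrow> 0 \<le> OPT k I"
  unfolding OPT_def instances_def using L_pos
  by (intro sum_list_nonneg) (fastforce dest: in_set_takeD)

text \<open>Seed 1 posts the highest prices and sells the fewest units, so it decides the case. If
  it serves everyone, all seeds do. If it sells \<open>k\<close> units, all seeds do, and the
  collected prices alone suffice. Otherwise the seeds split at a threshold \<open>x\<close>.\<close>

lemma CVaR_ALG_ge:
  assumes I: "I \<in> instances L U"
    and total: "(\<Sum>i=1..k. integral {0..\<delta>} (\<phi> i)) = real k * U * \<delta> / \<alpha>"
  shows "ereal (OPT k I / \<alpha>) \<le> CVaR \<delta> unit_seed (\<lambda>R. ALG k (cPPM \<phi> R) I)"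
proof -
  define T where "T = length I"
  define n where "n = (\<lambda>R. sold k (\<lambda>j. \<phi> j R) (nth I))"
  define i where "i = Suc (n 1 T)"
  have val: "L \<le> I ! t" "I ! t \<le> U" if "t < T" for t
  proof -
    have "I ! t \<in> {L..U}"
      using I nth_mem[of t I] that unfolding instances_def T_def by blast
    then show "L \<le> I ! t" "I ! t \<le> U" by auto
  qed
  have n_less: "n R' t \<le> n R t" "n R t \<le> Suc (n R' t)" if "0 \<le> R" "R \<le> R'" "R' \<le> 1" for R R' t
    unfolding n_def using that by (auto intro: sold_interlace_seeds)
  have ALG: "ALG k (cPPM \<phi> R) I = (\<Sum>t<T. I ! t * of_bool (buys k (\<lambda>j. \<phi> j R) (nth I) t))" for R
    unfolding ALG_cPPM T_def ..
  have ALG_ge: "(\<Sum>t<T. max (I ! t - w) 0) + (\<Sum>j=1..n R T. \<phi> j R) \<le> ALG k (cPPM \<phi> R) I"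
    if "\<And>t. t < T \<Longrightarrow> w < I ! t \<Longrightarrow> buys k (\<lambda>j. \<phi> j R) (nth I) t"
      "\<And>j. 1 \<le> j \<Longrightarrow> j \<le> n R T \<Longrightarrow> \<phi> j R \<le> w" for w R
    unfolding ALG n_def using that unfolding n_def by (rule welfare_ge)
  have OPT_le': "OPT k I \<le> real k * w + (\<Sum>t<T. max (I ! t - w) 0)" if "0 \<le> w" for w
    using OPT_le[OF that] by (simp add: T_def)
  consider (all) "n 1 T = T" | (full) "n 1 T = k" | (part) "n 1 T < T" "n 1 T < k"
    using sold_le_time[of k _ _ T] sold_le[of k _ _ T] unfolding n_def by (metis le_neq_implies_less)
  then show ?thesis
  proof cases
    case all
    have "buys k (\<lambda>j. \<phi> j R) (nth I) t" if "R \<in> {0..1}" "t < T" for R t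
    proof (rule buys_of_sold_eq_time[OF _ that(2)])
      show "sold k (\<lambda>j. \<phi> j R) (nth I) T = T"
        using n_less(1)[of R 1 T] all that(1) sold_le_time[of k "\<lambda>j. \<phi> j R" "nth I" T]
        by (simp add: n_def)
    qed
    then have "ereal (\<Sum>t<T. I ! t) \<le> CVaR \<delta> unit_seed (\<lambda>R. ALG k (cPPM \<phi> R) I)"
      by (intro CVaR_const) (auto simp: ALG)
    moreover have "OPT k I / \<alpha> \<le> (\<Sum>t<T. I ! t)"
    proof -
      have "OPT k I \<le> (\<Sum>t<T. max (I ! t - 0) 0)" using OPT_le'[of 0] by simp
      also have "\<dots> = (\<Sum>t<T. I ! t)" using val(1) L_pos by (intro sum.cong) (auto simp: max_def, force)
      finally have "OPT k I \<le> (\<Sum>t<T. I ! t)" .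
      moreover have "OPT k I / \<alpha> \<le> OPT k I / 1"
        using OPT_nonneg[OF I] \<alpha>_ge by (intro divide_left_mono) auto
      ultimately show ?thesis by simp
    qed
    ultimately show ?thesis by (meson ereal_less_eq(3) order.trans)
  next
    case full
    have nk: "n R T = k" if "0 \<le> R" "R \<le> 1" for R
      using n_less(1)[of R 1 T] that full sold_le[of k "\<lambda>j. \<phi> j R" "nth I" T] by (simp add: n_def)
    have "(\<Sum>j=1..k. \<phi> j R) \<le> ALG k (cPPM \<phi> R) I" if "0 \<le> R" "R \<le> 1" for R
    proof -
      have "(\<Sum>j=1..k. \<phi> j R) = (\<Sum>t<T. of_bool (buys k (\<lambda>j. \<phi> j R) (nth I) t) * \<phi> (Suc (n R t)) R)"
        using sum_sold[where f = "\<lambda>j. \<phi> j R" and q = "\<lambda>j. \<phi> j R" and T = T and k = k and v = "nth I"] nk[OF that]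
        by (simp add: n_def)
      also have "\<dots> \<le> ALG k (cPPM \<phi> R) I"
        unfolding ALG by (intro sum_mono) (auto simp: n_def)
      finally show ?thesis .
    qed
    \<comment> \<open>At level \<open>k\<close> and \<open>x = 1\<close> the window is
      \<open>[0, \<delta>]\<close>, so the bound becomes the quantity in
      \<open>total\<close>.\<close>
    then have "ereal (0 + ((\<Sum>j=1..k - 1. integral {1..min 1 (1 + \<delta>)} (\<phi> j)) +
        (\<Sum>j=1..k. integral {0..max 0 (\<delta> - 1 + 1)} (\<phi> j))) / \<delta>) \<le> CVaR \<delta> unit_seed (\<lambda>R. ALG k (cPPM \<phi> R) I)"
      using k_pos by (intro CVaR_ge_level) auto
    then have "ereal (real k * U / \<alpha>) \<le> CVaR \<delta> unit_seed (\<lambda>R. ALG k (cPPM \<phi> R) I)"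
      using \<delta>_pos total by (simp add: min_def)
    moreover have "OPT k I \<le> real k * U"
    proof (cases "T = 0")
      case True
      with I show ?thesis by (simp add: instances_def T_def)
    next
      case False
      then have "0 \<le> U" using val[of 0] L_pos by simp
      moreover have "(\<Sum>t<T. max (I ! t - U) 0) = 0" using val(2) by (intro sum.neutral) auto
      ultimately show ?thesis using OPT_le'[of U] by simp
    qed
    then have "OPT k I / \<alpha> \<le> real k * U / \<alpha>" using \<alpha>_ge by (intro divide_right_mono) auto
    ultimately show ?thesis by (meson ereal_less_eq(3) order.trans)
  next
    case part
    then have i: "1 \<le> i" "i \<le> k" by (auto simp: i_def)
    have n_cases: "n R T = i \<or> n R T = i - 1" if "R \<in> {0..1}" for R
      using n_less[of R 1 T] that by (auto simp: i_def)
    define S where "S = {R \<in> {0..1}. n R T = i}"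
    have notS: "n R T = i - 1" if "R \<in> {0..1}" "R \<notin> S" for R
      using n_cases[OF that(1)] that by (auto simp: S_def)
    have "1 \<notin> S" by (simp add: S_def i_def)
    have downS: "R \<in> S" if "R' \<in> S" "0 \<le> R" "R \<le> R'" for R R'
      using that n_less(1)[of R R' T] n_cases[of R] by (auto simp: S_def i_def)
    \<comment> \<open>\<open>S\<close> is an initial segment without 1, and \<open>x\<close> is its
      end; inserting 0 covers the empty segment. Whether \<open>x\<close> lies in \<open>S\<close>
      stays open.\<close>
    define x where "x = Sup (insert 0 S)"
    have bdd: "bdd_above (insert 0 S)" by (rule bdd_aboveI[of _ 1]) (auto simp: S_def)
    have xS: "R \<le> x" if "R \<in> S" for R unfolding x_def using that bdd by (intro cSup_upper) auto
    have x: "x \<in> {0..1}"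
      unfolding x_def using bdd by (auto simp: S_def intro!: cSup_upper cSup_least)
    have Sx: "R \<in> S" if R: "0 \<le> R" "R < x" for R
    proof -
      obtain R' where "R' \<in> insert 0 S" "R < R'"
        using R(2) less_cSup_iff[OF _ bdd, of R] by (auto simp: x_def)
      with R downS[of R' R] show ?thesis by auto
    qed
    \<comment> \<open>Such a seed sold fewer than \<open>T\<close> units and had some left, so it
      refused a buyer: the price then posted exceeded a value of at least \<open>L\<close>, and it
      is at most \<open>\<phi> i R\<close>.\<close>
    have gt_L: "L < \<phi> i R" if R: "R \<in> {0..1}" "R \<notin> S" for R
    proof -
      have "\<exists>t<T. \<not> buys k (\<lambda>j. \<phi> j R) (nth I) t"
      proof (rule ccontr)
        assume "\<not> ?thesis"
        then have "n R t = t" if "t \<le> T" for t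
          using that
        proof (induction t)
          case (Suc t)
          then have "buys k (\<lambda>j. \<phi> j R) (nth I) t"
            using \<open>\<not> (\<exists>t<T. \<not> buys k (\<lambda>j. \<phi> j R) (nth I) t)\<close> by auto
          with Suc show ?case by (simp add: n_def)
        qed (simp add: n_def)
        with notS[OF R] part show False by (simp add: i_def)
      qed
      then obtain t where t: "t < T" "\<not> buys k (\<lambda>j. \<phi> j R) (nth I) t" by blast
      have "n R t < i" using sold_mono[of t T k "\<lambda>j. \<phi> j R" "nth I"] t(1) notS[OF R] i
        by (simp add: n_def)
      then have "I ! t < \<phi> (Suc (n R t)) R" using t(2) i by (auto simp: n_def)
      also have "\<dots> \<le> \<phi> i R" using \<open>n R t < i\<close> i R by (intro price_le_level) auto
      finally show ?thesis using val(1)[OF t(1)] by simp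
    qed
    have mi: "m < i"
      using gt_L[of 1] \<open>1 \<notin> S\<close> price_eq_L[OF i, of 1] by force
    \<comment> \<open>Otherwise the midpoint of \<open>x\<close> and \<open>flat_end\<close> would
      be a seed outside \<open>S\<close> whose price is \<open>L\<close>.\<close>
    have bx: "flat_end \<le> x" if "i = Suc m"
    proof (rule ccontr)
      assume "\<not> flat_end \<le> x"
      then have "(x + flat_end) / 2 \<in> {0..1}" "(x + flat_end) / 2 \<notin> S" "(x + flat_end) / 2 \<le> flat_end"
        using x flat_end_bounds xS[of "(x + flat_end) / 2"] by auto
      then show False using gt_L[of "(x + flat_end) / 2"] price_eq_L[OF i, of "(x + flat_end) / 2"] that by auto
    qed
    define w where "w = \<phi> i x"
    have "L \<le> w" unfolding w_def using i x by (intro price_ge_L) auto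
    \<comment> \<open>\<open>buys_under_all_seeds\<close> needs a seed that sold fewer than
      \<open>i\<close> units. If \<open>x\<close> is not one, a seed slightly to its right is: only
      finitely many values exceed \<open>w\<close>, and by continuity \<open>\<phi> i\<close> stays
      below them.\<close>
    obtain R' where R': "R' \<in> {0..1}" "R' \<notin> S" "\<And>t. t < T \<Longrightarrow> w < I ! t \<Longrightarrow> \<phi> i R' < I ! t"
    proof (cases "x \<in> S")
      case False
      then show ?thesis using x by (intro that[of x]) (auto simp: w_def)
    next
      case True
      then have "x < 1" using x \<open>1 \<notin> S\<close> by (cases "x = 1") auto
      have "continuous (at x within {0..1}) (\<phi> i)"
        using continuous_price[OF i] x by (auto simp: continuous_on_eq_continuous_within)
      then have "(\<phi> i \<longlongrightarrow> w) (at x within {0..1})" by (simp add: continuous_within w_def)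
      then have lim: "(\<phi> i \<longlongrightarrow> w) (at x within {x..1})"
        by (rule tendsto_within_subset) (use x in auto)
      have 1: "\<forall>\<^sub>F R in at x within {x..1}. \<forall>v\<in>{I ! t |t. t < T \<and> w < I ! t}. \<phi> i R < v"
        using order_tendstoD(2)[OF lim] by (intro eventually_ball_finite) auto
      have 2: "at x within {x..1} \<noteq> bot"
        using \<open>x < 1\<close> by (simp add: at_within_Icc_at_right)
      have 3: "\<forall>\<^sub>F R in at x within {x..1}. R \<in> {x..1} \<and> R \<noteq> x"
        by (auto simp: eventually_at_topological)
      obtain R where "R \<in> {x..1}" "R \<noteq> x" "\<forall>v\<in>{I ! t |t. t < T \<and> w < I ! t}. \<phi> i R < v"
        using eventually_happens'[OF 2 eventually_conj[OF 1 3]] by blast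
      then show ?thesis using x xS[of R] by (intro that[of R]) auto
    qed
    define E where "E = (\<Sum>t<T. max (I ! t - w) 0)"
    have main: "E + (\<Sum>j=1..n R T. \<phi> j R) \<le> ALG k (cPPM \<phi> R) I" if R: "R \<in> {0..1}" for R
      unfolding E_def
    proof (rule ALG_ge)
      fix t assume t: "t < T" "w < I ! t"
      then show "buys k (\<lambda>j. \<phi> j R) (nth I) t"
        using notS[OF R'(1,2)] R'(3)[OF t] i
        by (intro buys_under_all_seeds[OF R R'(1), of i _ T]) (auto simp: n_def)
    next
      fix j assume j: "1 \<le> j" "j \<le> n R T"
      show "\<phi> j R \<le> w"
      proof (cases "j = i")
        case True
        then have "R \<in> S" using j n_cases[OF R] R i by (auto simp: S_def)
        then have "R \<le> x" by (rule xS)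
        then show ?thesis unfolding w_def True using i R x by (intro price_mono) auto
      next
        case False
        then show ?thesis unfolding w_def using i j R x n_cases[OF R] by (intro price_le_next_level) auto
      qed
    qed
    have C: "ereal (E + ((\<Sum>j=1..i - 1. integral {x..min 1 (x + \<delta>)} (\<phi> j)) +
        (\<Sum>j=1..i. integral {0..max 0 (\<delta> - 1 + x)} (\<phi> j))) / \<delta>) \<le> CVaR \<delta> unit_seed (\<lambda>R. ALG k (cPPM \<phi> R) I)"
    proof (rule CVaR_ge_level[OF i x])
      fix R assume "0 \<le> R" "R < x"
      then show "E + (\<Sum>j=1..i. \<phi> j R) \<le> ALG k (cPPM \<phi> R) I"
        using main[of R] Sx[of R] x by (auto simp: S_def)
    next
      fix R assume "x < R" "R \<le> 1"
      then show "E + (\<Sum>j=1..i - 1. \<phi> j R) \<le> ALG k (cPPM \<phi> R) I"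
        using main[of R] notS[of R] xS[of R] x by force
    qed
    \<comment> \<open>The integral equation at \<open>(i, x)\<close>, solved for the integrals over
      the window.\<close>
    have W: "((\<Sum>j=1..i - 1. integral {x..min 1 (x + \<delta>)} (\<phi> j)) +
        (\<Sum>j=1..i. integral {0..max 0 (\<delta> - 1 + x)} (\<phi> j))) / \<delta> = real k * w / \<alpha>"
    proof -
      have "Z / \<delta> = real k * w / \<alpha>" if "w = \<alpha> / (real k * \<delta>) * Z" for Z
        using that \<alpha>_ge \<delta>_pos k_pos by simp
      then show ?thesis using price_eq[OF i mi x bx] unfolding w_def .
    qed
    have "OPT k I / \<alpha> \<le> E + real k * w / \<alpha>"
    proof -
      have "0 \<le> E" unfolding E_def by (intro sum_nonneg) auto
      then have "E / \<alpha> \<le> E" using \<alpha>_ge by (simp add: divide_le_eq mult_le_cancel_left1)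
      moreover have "OPT k I / \<alpha> \<le> (real k * w + E) / \<alpha>"
        using OPT_le'[of w] \<open>L \<le> w\<close> L_pos \<alpha>_ge unfolding E_def by (intro divide_right_mono) auto
      ultimately show ?thesis by (simp add: add_divide_distrib)
    qed
    then have "ereal (OPT k I / \<alpha>) \<le> ereal (E + real k * w / \<alpha>)" by simp
    also have "\<dots> \<le> CVaR \<delta> unit_seed (\<lambda>R. ALG k (cPPM \<phi> R) I)" using C unfolding W .
    finally show ?thesis .
  qed
qed

end

subsection \<open>Tightness\<close>

text \<open>Otherwise all \<open>k\<close> buyers preceding \<open>t\<close> would have bought, since prices only rise.\<close>

lemma earlier_value_less_price:
  assumes "sold k q v t < k" "k \<le> t"
    and v: "\<And>s. t - k \<le> s \<Longrightarrow> s < t \<Longrightarrow> v (t - k) \<le> v s"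
    and q: "\<And>i j. 1 \<le> i \<Longrightarrow> i \<le> j \<Longrightarrow> j \<le> k \<Longrightarrow> q i \<le> q j"
  shows "v (t - k) < q (Suc (sold k q v t))"
proof (rule ccontr)
  assume *: "\<not> ?thesis"
  have "s \<le> sold k q v (t - k + s)" if "s \<le> k" for s
    using that
  proof (induction s)
    case (Suc s)
    have le: "sold k q v (t - k + s) \<le> sold k q v t"
      using Suc.prems \<open>k \<le> t\<close> by (intro sold_mono) auto
    then have "q (Suc (sold k q v (t - k + s))) \<le> q (Suc (sold k q v t))"
      using assms(1) by (intro q) auto
    also have "\<dots> \<le> v (t - k)" using * by simp
    also have "\<dots> \<le> v (t - k + s)" using Suc.prems \<open>k \<le> t\<close> by (intro v) auto
    finally show ?case using Suc le assms(1) by auto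
  qed simp
  from this[of k] assms(1,2) show False by simp
qed

context pricing
begin

section \<open>Measurability and boundedness of the welfare\<close>

lemma price_measurable:
  assumes "1 \<le> i" "i \<le> k"
  shows "\<phi> i \<in> borel_measurable unit_seed"
proof -
  have "sets unit_seed = sets (restrict_space borel {0..1})"
    unfolding unit_seed_def by (intro sets_restrict_space_cong) simp
  moreover have "\<phi> i \<in> borel_measurable (restrict_space borel {0..1})"
    using continuous_price[OF assms] by (rule borel_measurable_continuous_on_restrict)
  ultimately show ?thesis by (simp cong: measurable_cong_sets)
qed

text \<open>The next price has a random level. The count takes countably many values, so it can be
  fixed to some \<open>n\<close>; a price matters only for \<open>n < k\<close>, where it is
  continuous.\<close>

lemma sold_measurable: "(\<lambda>R. sold k (\<lambda>j. \<phi> j R) v t) \<in> measurable unit_seed (count_space UNIV)"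
proof (induction t)
  case (Suc t)
  have "(\<lambda>R. n + of_bool (n < k \<and> \<phi> (Suc n) R \<le> v t)) \<in> measurable unit_seed (count_space UNIV)" for n :: nat
  proof (cases "n < k")
    case True
    then have [measurable]: "\<phi> (Suc n) \<in> borel_measurable unit_seed"
      by (intro price_measurable) auto
    show ?thesis unfolding of_bool_def by measurable
  qed simp
  from measurable_compose_countable[where
      f = "\<lambda>n R. n + of_bool (n < k \<and> \<phi> (Suc n) R \<le> v t)", OF this Suc]
  show ?case by (simp only: sold.simps)
qed simp

lemma ALG_measurable: "(\<lambda>R. ALG k (cPPM \<phi> R) I) \<in> borel_measurable unit_seed"
proof -
  \<comment> \<open>The indicator of a sale is an increment of the measurable count.\<close>
  have "ALG k (cPPM \<phi> R) I = (\<Sum>t<length I. I ! t *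
      (real (sold k (\<lambda>j. \<phi> j R) (nth I) (Suc t)) - real (sold k (\<lambda>j. \<phi> j R) (nth I) t)))" for R
    by (simp add: ALG_cPPM)
  moreover have [measurable]: "(\<lambda>R. real (sold k (\<lambda>j. \<phi> j R) v t)) \<in> borel_measurable unit_seed" for v t
    by (rule measurable_compose[OF sold_measurable]) simp
  ultimately show ?thesis by (simp only:) measurable
qed

lemma ALG_bounded: "\<bar>ALG k (cPPM \<phi> R) I\<bar> \<le> (\<Sum>t<length I. \<bar>I ! t\<bar>)"
  unfolding ALG_cPPM by (rule order.trans[OF sum_abs], rule sum_mono) (simp add: abs_mult of_bool_def)

section \<open>Almost tight instances\<close>

definition grid :: "real \<Rightarrow> nat \<Rightarrow> real list" where
  "grid U N = map (\<lambda>t. L + real (t div k) * ((U - L) / N)) [0..<k * N + k]"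

lemma grid_nth: "t < k * N + k \<Longrightarrow> grid U N ! t = L + real (t div k) * ((U - L) / N)"
  by (simp add: grid_def)

lemma length_grid: "length (grid U N) = k * N + k"
  by (simp add: grid_def)

lemma grid_mono:
  assumes "L \<le> U" "s \<le> t" "t < k * N + k"
  shows "grid U N ! s \<le> grid U N ! t"
proof -
  have "real (s div k) * ((U - L) / N) \<le> real (t div k) * ((U - L) / N)"
    using assms by (intro mult_right_mono of_nat_mono div_le_mono) auto
  with assms show ?thesis by (simp add: grid_nth)
qed

lemma grid_top:
  assumes "0 < N" "k * N \<le> t" "t < k * N + k"
  shows "grid U N ! t = U"
proof -
  have "t div k = N" using assms k_pos by (intro div_nat_eqI) (auto simp: algebra_simps)
  with assms show ?thesis by (simp add: grid_nth)
qed

lemma grid_instance: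
  assumes "L \<le> U" "0 < N"
  shows "grid U N \<in> instances L U"
proof -
  have "L \<le> grid U N ! t \<and> grid U N ! t \<le> U" if "t < k * N + k" for t
  proof -
    have "0 < k * N + k" "grid U N ! 0 = L" using k_pos by (auto simp: grid_nth)
    then show ?thesis
      using grid_mono[OF assms(1), of 0 t N] grid_mono[OF assms(1), of t "k * N + k - 1" N] that
        grid_top[OF assms(2), of "k * N + k - 1" U] by auto
  qed
  moreover have "grid U N \<noteq> []" using k_pos by (simp add: grid_def)
  ultimately show ?thesis by (auto simp: instances_def in_set_conv_nth length_grid)
qed

lemma OPT_grid:
  assumes "L \<le> U" "0 < N"
  shows "OPT k (grid U N) = real k * U"
proof -
  have "sorted (grid U N)"
    using grid_mono[OF assms(1)] by (auto simp: sorted_iff_nth_mono length_grid)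
  then have "OPT k (grid U N) = sum_list (take k (rev (grid U N)))"
    by (simp add: OPT_def sorted_sort_id)
  also have "take k (rev (grid U N)) = replicate k U"
    by (rule nth_equalityI) (auto simp: length_grid rev_nth intro!: grid_top[OF assms(2)])
  finally show ?thesis by (simp add: sum_list_replicate)
qed

text \<open>The buyer \<open>k\<close> places earlier has a value one grid step lower, which
  \<open>earlier_value_less_price\<close> puts below the current price. So a sale exceeds its price
  by at most one step; the first \<open>k\<close> buyers have value \<open>L\<close>, below which no
  price lies.\<close>

lemma ALG_grid_le:
  assumes "L \<le> U" "0 < N" and R: "R \<in> {0..1}"
  shows "ALG k (cPPM \<phi> R) (grid U N) \<le> real k * ((U - L) / N) + (\<Sum>j=1..k. \<phi> j R)"
proof -
  define \<epsilon> where "\<epsilon> = (U - L) / N"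
  have "0 \<le> \<epsilon>" using assms by (simp add: \<epsilon>_def)
  define q where "q = (\<lambda>j. \<phi> j R)"
  define v where "v = nth (grid U N)"
  let ?T = "k * N + k"
  have q: "q i \<le> q j" if "1 \<le> i" "i \<le> j" "j \<le> k" for i j
    unfolding q_def using that R by (rule price_le_level)
  have qL: "L \<le> q j" if "1 \<le> j" "j \<le> k" for j
    unfolding q_def using that R by (rule price_ge_L)
  have sale: "v t \<le> q (Suc (sold k q v t)) + \<epsilon>" if t: "t < ?T" "sold k q v t < k" for t
  proof (cases "t < k")
    case True
    then have "v t = L" using t by (simp add: v_def grid_nth)
    with qL[of "Suc (sold k q v t)"] t \<open>0 \<le> \<epsilon>\<close> show ?thesis by simp
  next
    case False
    then have "t div k = Suc ((t - k) div k)" using k_pos by (simp add: le_div_geq)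
    then have "v t = v (t - k) + \<epsilon>"
      using t(1) by (simp add: v_def grid_nth \<epsilon>_def[symmetric] algebra_simps)
    moreover have "v (t - k) < q (Suc (sold k q v t))"
      using t False q grid_mono[OF assms(1)]
      by (intro earlier_value_less_price) (auto simp: v_def)
    ultimately show ?thesis by simp
  qed
  have "ALG k (cPPM \<phi> R) (grid U N) = (\<Sum>t<?T. v t * of_bool (buys k q v t))"
    by (simp add: ALG_cPPM length_grid v_def q_def)
  also have "\<dots> \<le> (\<Sum>t<?T. of_bool (buys k q v t) * (q (Suc (sold k q v t)) + \<epsilon>))"
    using sale by (intro sum_mono) auto
  also have "\<dots> = (\<Sum>j=1..sold k q v ?T. q j + \<epsilon>)"
    by (rule sum_sold[symmetric])
  also have "\<dots> \<le> (\<Sum>j=1..k. q j + \<epsilon>)"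
    using sold_le[of k q v ?T] qL L_pos \<open>0 \<le> \<epsilon>\<close> by (intro sum_mono2) (auto intro: add_nonneg_nonneg order.trans[OF less_imp_le])
  also have "\<dots> = real k * \<epsilon> + (\<Sum>j=1..k. \<phi> j R)"
    by (simp add: sum.distrib q_def)
  finally show ?thesis unfolding \<epsilon>_def .
qed

lemma CVaR_ALG_grid_le:
  assumes "L \<le> U" "0 < N"
    and total: "(\<Sum>i=1..k. integral {0..\<delta>} (\<phi> i)) = real k * U * \<delta> / \<alpha>"
  shows "CVaR \<delta> unit_seed (\<lambda>R. ALG k (cPPM \<phi> R) (grid U N)) \<le>
    ereal (real k * ((U - L) / N) + real k * U / \<alpha>)"
proof -
  let ?f = "\<lambda>R. real k * ((U - L) / N) + (\<Sum>j=1..k. \<phi> j R)"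
  have "CVaR \<delta> unit_seed (\<lambda>R. ALG k (cPPM \<phi> R) (grid U N)) \<le> ereal (integral {0..\<delta>} ?f / \<delta>)"
    using \<delta>_pos \<delta>_le
    by (intro CVaR_unit_seed_le[OF _ _ _ ALG_measurable ALG_bounded] continuous_sum_price ALG_grid_le assms)
      auto
  also have "integral {0..\<delta>} ?f = (\<delta> - 0) * (real k * ((U - L) / N)) + real k * U * \<delta> / \<alpha>"
    unfolding total[symmetric] using \<delta>_pos \<delta>_le by (intro integral_sum_price) auto
  also have "\<dots> / \<delta> = real k * ((U - L) / N) + real k * U / \<alpha>"
    using \<delta>_pos by (simp add: add_divide_distrib)
  finally show ?thesis .
qed

section \<open>The competitive ratio\<close>

lemma CVaR_CR_cPPM:
  assumes "L \<le> U"
    and total: "(\<Sum>i=1..k. integral {0..\<delta>} (\<phi> i)) = real k * U * \<delta> / \<alpha>"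
  shows "CVaR_CR \<delta> k L U unit_seed (cPPM \<phi>) = ereal \<alpha>"
proof (rule antisym)
  let ?C = "\<lambda>I. CVaR \<delta> unit_seed (\<lambda>R. ALG k (cPPM \<phi> R) I)"
  have "ereal (OPT k I) / ?C I \<le> ereal \<alpha>" if I: "I \<in> instances L U" for I
  proof (cases "OPT k I = 0")
    case True
    then show ?thesis using \<alpha>_ge by (simp flip: zero_ereal_def)
  next
    case False
    with OPT_nonneg[OF I] have "0 < OPT k I / \<alpha>" using \<alpha>_ge by simp
    have ge: "ereal (OPT k I / \<alpha>) \<le> ?C I" using I total by (rule CVaR_ALG_ge)
    show ?thesis
    \<comment> \<open>As a supremum, \<open>?C I\<close> might a priori be infinite. The value
      \<open>\<infinity>\<close> makes the quotient 0, and \<open>ge\<close> excludes the other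
      one.\<close>
    proof (cases "?C I")
      case (real c)
      with ge have "OPT k I / \<alpha> \<le> c" by simp
      moreover from this \<open>0 < OPT k I / \<alpha>\<close> have "0 < c" by simp
      ultimately have "OPT k I / c \<le> \<alpha>" using \<alpha>_ge by (simp add: field_simps)
      with real \<open>0 < c\<close> show ?thesis by simp
    qed (use ge \<alpha>_ge in auto)
  qed
  then show "CVaR_CR \<delta> k L U unit_seed (cPPM \<phi>) \<le> ereal \<alpha>"
    unfolding CVaR_CR_def by (rule SUP_least)
next
  let ?C = "\<lambda>I. CVaR \<delta> unit_seed (\<lambda>R. ALG k (cPPM \<phi> R) I)"
  have U: "0 < real k * U" using L_pos k_pos assms(1) by simp
  \<comment> \<open>A lower bound for the ratio on the grid with \<open>Suc N\<close> steps, a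
    number that is never 0; it tends to \<open>\<alpha>\<close>.\<close>
  define r where "r = (\<lambda>N. real k * U / (real k * ((U - L) / real (Suc N)) + real k * U / \<alpha>))"
  have ub: "ereal (r N) \<le> CVaR_CR \<delta> k L U unit_seed (cPPM \<phi>)" for N
  proof -
    let ?I = "grid U (Suc N)"
    have I: "?I \<in> instances L U" using assms by (intro grid_instance) auto
    have O: "OPT k ?I = real k * U" using assms by (intro OPT_grid) auto
    have pos: "0 < real k * U / \<alpha>" using U \<alpha>_ge by simp
    have ge: "ereal (real k * U / \<alpha>) \<le> ?C ?I"
      using CVaR_ALG_ge[OF I total] unfolding O .
    have le: "?C ?I \<le> ereal (real k * ((U - L) / real (Suc N)) + real k * U / \<alpha>)"
      using assms by (intro CVaR_ALG_grid_le) auto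
    obtain c where c: "?C ?I = ereal c"
      using ge le by (cases "?C ?I") auto
    have "real k * U / \<alpha> \<le> c" "c \<le> real k * ((U - L) / real (Suc N)) + real k * U / \<alpha>"
      using ge le unfolding c by (simp_all only: ereal_less_eq)
    then have "r N \<le> real k * U / c" "c \<noteq> 0"
      unfolding r_def using U pos by (intro divide_left_mono mult_pos_pos, linarith+)
    then have "ereal (r N) \<le> ereal (OPT k ?I) / ?C ?I"
      unfolding O c by simp
    also have "\<dots> \<le> CVaR_CR \<delta> k L U unit_seed (cPPM \<phi>)"
      unfolding CVaR_CR_def using I by (rule SUP_upper)
    finally show ?thesis .
  qed
  have lim: "(\<lambda>N. ereal (r N)) \<longlonglongrightarrow> ereal \<alpha>"
  proof -
    have "(\<lambda>N. (U - L) / real (Suc N)) \<longlonglongrightarrow> 0"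
      using LIMSEQ_Suc[OF lim_const_over_n[of "U - L"]] .
    then have "r \<longlonglongrightarrow> real k * U / (real k * 0 + real k * U / \<alpha>)"
      unfolding r_def using U \<alpha>_ge
      by (intro tendsto_divide tendsto_add tendsto_mult tendsto_const) (use k_pos in auto)
    also have "real k * U / (real k * 0 + real k * U / \<alpha>) = \<alpha>"
    proof -
      have "U \<noteq> 0" "k \<noteq> 0" using U k_pos by auto
      then show ?thesis using \<alpha>_ge by simp
    qed
    finally show ?thesis by (rule tendsto_ereal)
  qed
  show "ereal \<alpha> \<le> CVaR_CR \<delta> k L U unit_seed (cPPM \<phi>)"
    by (rule LIMSEQ_le_const2[OF lim]) (use ub in blast)
qed

end

theorem theorem5:
  fixes L U \<delta> \<alpha> :: real and k :: nat and \<phi> :: "nat \<Rightarrow> real \<Rightarrow> real"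
  assumes "0 < L" and "L \<le> U"
    and "1 \<le> k"
    and "0 < \<delta>" and "\<delta> \<le> 1"
    and "1 \<le> \<alpha>"
    and "\<alpha> = real k * U * \<delta> / (\<Sum>i=1..k. integral {0..\<delta>} (\<phi> i))"
    and "pricing_equations \<delta> k L \<alpha> \<phi>"
  shows "CVaR_CR \<delta> k L U unit_seed (cPPM \<phi>) = ereal \<alpha>"
proof -
  interpret pricing k L \<delta> \<alpha> \<phi>
    by unfold_locales (fact assms)+
  define S where "S = (\<Sum>i=1..k. integral {0..\<delta>} (\<phi> i))"
  have \<alpha>: "\<alpha> = real k * U * \<delta> / S" unfolding S_def by (fact assms(7))
  \<comment> \<open>Division by 0 yields 0, which would contradict
    \<open>1 \<le> \<alpha>\<close>.\<close>
  with assms(6) have "S \<noteq> 0" by auto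
  with \<alpha> assms(6) have "S = real k * U * \<delta> / \<alpha>" by (simp add: field_simps)
  then show ?thesis unfolding S_def using assms(2) by (intro CVaR_CR_cPPM)
qed

end
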